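(* Let $G=\langle S\mid T\rangle$ be a group with generators $S$ and relations (relators) $T$. Let $R$ be a commutative unital ring, $\alpha:G\times G\to U(R)$ a normalized $2$-cocycle, and $f:S\to R^\alpha G$ a map. For words $w$ in the letters $S\cup S^{-1}$ define $f^*(w)\in R^\alpha G$ by $$ f^*(w)=\begin{cases} f(w) & \text{if } w\in S,\\ -\dfrac{1}{\alpha(w,w^{-1})}\,\overline{w}\,f(w^{-1})\,\overline{w} & \text{if } w\in S^{-1},\\ 0 & \text{if } w=1,\\ \dfrac{1}{\beta_w}\displaystyle\sum_{i=1}^{k}\Big(\prod_{j=1}^{i-1}\overline{w_j}\Big)f^*(w_i)\Big(\prod_{j=i+1}^{k}\overline{w_j}\Big) & \text{if } w=\prod_{i=1}^k w_i,\ w_i\in S\cup S^{-1}, \end{cases} \qquad \beta_w=\prod_{i=1}^{k-1}\alpha\Big(w_i,\prod_{j=i+1}^{k}w_j\Big). $$ Then: 1. If there exists an $R$-derivation of $R^\alpha G$ extending $f$, then it is unique and is given by $f^*$ extended by linearity; that is, it sends $\overline{g}$ to $f^*(w)$ for every $g\in G$ and every word $w$ representing $g$. 2. There exists an $R$-derivation of $R^\alpha G$ extending $f$ if and only if $f^*(T)=0$, i.e. $f^*(t)=0$ for every relator word $t\in T$.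
   Context: A $2$-cocycle is a map $\alpha:G\times G\to U(R)$ (units of $R$) with $\alpha(x,y)\alpha(xy,z)=\alpha(y,z)\alpha(x,yz)$ for all $x,y,z\in G$; it is normalized if $\alpha(1,g)=\alpha(g,1)=1$ for all $g\in G$. The twisted group ring $R^\alpha G$ is the free $R$-module with basis $\{\overline{g}:g\in G\}$ and product $(a\overline{g})(b\overline{h})=ab\,\alpha(g,h)\,\overline{gh}$, extended by linearity; $R$ is identified with $R\,\overline{1}$. A derivation of a ring $A$ is an additive map $d:A\to A$ with $d(ab)=d(a)b+a\,d(b)$ for all $a,b\in A$; a derivation $d$ of $R^\alpha G$ is an $R$-derivation if $d(R)=\{0\}$. It extends $f:S\to R^\alpha G$ if $d(\overline{s})=f(s)$ for all $s\in S$. In the formula for $f^*$, the elements of $S\cup S^{-1}$ are treated as formal letters, a bar over a letter denotes the basis element of $R^\alpha G$ attached to the corresponding element of $G$, and arguments of $\alpha$ are evaluated in $G$. The word $1$ is the empty word. *)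

theory Defs
  imports "HOL-Algebra.Coset" "HOL-Algebra.Module"
begin

section \<open>Words and group presentations\<close>

datatype 's letter = Gen 's | Inv 's

primrec letter_inv :: "'s letter \<Rightarrow> 's letter" where
  "letter_inv (Gen s) = Inv s"
| "letter_inv (Inv s) = Gen s"

definition words :: "'s set \<Rightarrow> 's letter list set" where
  "words S = lists (Gen ` S \<union> Inv ` S)"

inductive_set free_rel :: "'s set \<Rightarrow> ('s letter list \<times> 's letter list) set" for S where
  refl: "u \<in> words S \<Longrightarrow> (u, u) \<in> free_rel S"
| sym: "(u, v) \<in> free_rel S \<Longrightarrow> (v, u) \<in> free_rel S"
| trans: "(u, v) \<in> free_rel S \<Longrightarrow> (v, w) \<in> free_rel S \<Longrightarrow> (u, w) \<in> free_rel S"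
| cancel: "u @ [x, letter_inv x] @ v \<in> words S \<Longrightarrow>
    (u @ [x, letter_inv x] @ v, u @ v) \<in> free_rel S"

definition free_group :: "'s set \<Rightarrow> 's letter list set monoid" where
  "free_group S =
    \<lparr>carrier = words S // free_rel S,
     mult = (\<lambda>U V. \<Union>u\<in>U. \<Union>v\<in>V. free_rel S `` {u @ v}),
     one = free_rel S `` {[]}\<rparr>"

definition normal_closure :: "('a, 'm) monoid_scheme \<Rightarrow> 'a set \<Rightarrow> 'a set" where
  "normal_closure G A = \<Inter>{N. N \<lhd> G \<and> A \<subseteq> N}"

definition relator_subgroup :: "'s set \<Rightarrow> 's letter list set \<Rightarrow> 's letter list set set" where
  "relator_subgroup S T = normal_closure (free_group S) ((\<lambda>t. free_rel S `` {t}) ` T)"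

definition presented_group :: "'s set \<Rightarrow> 's letter list set \<Rightarrow> 's letter list set set monoid" where
  "presented_group S T = free_group S Mod relator_subgroup S T"

text \<open>
  \<open>presentation G \<iota> S T\<close> says that \<open>G\<close> is the group presented by \<open>S\<close> and \<open>T\<close>, where the
  generator \<open>s\<close> names the element \<open>\<iota> s\<close> of \<open>G\<close>. The map \<open>\<iota>\<close> need not be injective, and it may
  happen that \<open>\<iota> s\<close> is the inverse of \<open>\<iota> s'\<close>: generators are letters, not elements of \<open>G\<close>.
\<close>

definition presentation ::
  "('g, 'm) monoid_scheme \<Rightarrow> ('s \<Rightarrow> 'g) \<Rightarrow> 's set \<Rightarrow> 's letter list set \<Rightarrow> bool" where
  "presentation G \<iota> S T \<longleftrightarrow>
    T \<subseteq> words S \<and>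
    (\<exists>\<phi>\<in>iso (presented_group S T) G.
      \<forall>s\<in>S. \<phi> (relator_subgroup S T #>\<^bsub>free_group S\<^esub> (free_rel S `` {[Gen s]})) = \<iota> s)"

primrec letter_val :: "('g, 'm) monoid_scheme \<Rightarrow> ('s \<Rightarrow> 'g) \<Rightarrow> 's letter \<Rightarrow> 'g" where
  "letter_val G \<iota> (Gen s) = \<iota> s"
| "letter_val G \<iota> (Inv s) = inv\<^bsub>G\<^esub> (\<iota> s)"

definition word_val :: "('g, 'm) monoid_scheme \<Rightarrow> ('s \<Rightarrow> 'g) \<Rightarrow> 's letter list \<Rightarrow> 'g" where
  "word_val G \<iota> w = foldr (\<otimes>\<^bsub>G\<^esub>) (map (letter_val G \<iota>) w) \<one>\<^bsub>G\<^esub>"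


section \<open>Twisted group rings\<close>

definition normalized_cocycle ::
  "('r, 'n) ring_scheme \<Rightarrow> ('g, 'm) monoid_scheme \<Rightarrow> ('g \<Rightarrow> 'g \<Rightarrow> 'r) \<Rightarrow> bool" where
  "normalized_cocycle R G \<alpha> \<longleftrightarrow>
    (\<forall>x\<in>carrier G. \<forall>y\<in>carrier G. \<alpha> x y \<in> Units R) \<and>
    (\<forall>x\<in>carrier G. \<forall>y\<in>carrier G. \<forall>z\<in>carrier G.
      \<alpha> x y \<otimes>\<^bsub>R\<^esub> \<alpha> (x \<otimes>\<^bsub>G\<^esub> y) z = \<alpha> y z \<otimes>\<^bsub>R\<^esub> \<alpha> x (y \<otimes>\<^bsub>G\<^esub> z)) \<and>
    (\<forall>g\<in>carrier G. \<alpha> \<one>\<^bsub>G\<^esub> g = \<one>\<^bsub>R\<^esub> \<and> \<alpha> g \<one>\<^bsub>G\<^esub> = \<one>\<^bsub>R\<^esub>)"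

definition supp :: "('r, 'n) ring_scheme \<Rightarrow> ('g, 'm) monoid_scheme \<Rightarrow> ('g \<Rightarrow> 'r) \<Rightarrow> 'g set" where
  "supp R G a = {g \<in> carrier G. a g \<noteq> \<zero>\<^bsub>R\<^esub>}"

definition basis_elt ::
  "('r, 'n) ring_scheme \<Rightarrow> ('g, 'm) monoid_scheme \<Rightarrow> 'g \<Rightarrow> 'g \<Rightarrow> 'r" where
  "basis_elt R G g = (\<lambda>h\<in>carrier G. if h = g then \<one>\<^bsub>R\<^esub> else \<zero>\<^bsub>R\<^esub>)"

text \<open>Elements are the coefficient functions with respect to the basis \<open>basis_elt R G g\<close>.\<close>

definition twisted_group_ring ::
  "('r, 'n) ring_scheme \<Rightarrow> ('g, 'm) monoid_scheme \<Rightarrow> ('g \<Rightarrow> 'g \<Rightarrow> 'r) \<Rightarrow> ('r, 'g \<Rightarrow> 'r) module"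
  where
  "twisted_group_ring R G \<alpha> =
    \<lparr>carrier = {a \<in> carrier G \<rightarrow>\<^sub>E carrier R. finite (supp R G a)},
     mult = (\<lambda>a b. \<lambda>k\<in>carrier G.
       finsum R (\<lambda>(g, h). a g \<otimes>\<^bsub>R\<^esub> b h \<otimes>\<^bsub>R\<^esub> \<alpha> g h)
         {(g, h) \<in> supp R G a \<times> supp R G b. g \<otimes>\<^bsub>G\<^esub> h = k}),
     one = basis_elt R G \<one>\<^bsub>G\<^esub>,
     zero = (\<lambda>k\<in>carrier G. \<zero>\<^bsub>R\<^esub>),
     add = (\<lambda>a b. \<lambda>k\<in>carrier G. a k \<oplus>\<^bsub>R\<^esub> b k),
     smult = (\<lambda>r a. \<lambda>k\<in>carrier G. r \<otimes>\<^bsub>R\<^esub> a k)\<rparr>"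


section \<open>Derivations\<close>

definition derivation :: "('a, 'm) ring_scheme \<Rightarrow> ('a \<Rightarrow> 'a) \<Rightarrow> bool" where
  "derivation A d \<longleftrightarrow>
    d \<in> carrier A \<rightarrow> carrier A \<and>
    (\<forall>a\<in>carrier A. \<forall>b\<in>carrier A. d (a \<oplus>\<^bsub>A\<^esub> b) = d a \<oplus>\<^bsub>A\<^esub> d b) \<and>
    (\<forall>a\<in>carrier A. \<forall>b\<in>carrier A. d (a \<otimes>\<^bsub>A\<^esub> b) = d a \<otimes>\<^bsub>A\<^esub> b \<oplus>\<^bsub>A\<^esub> a \<otimes>\<^bsub>A\<^esub> d b)"

definition R_derivation ::
  "('r, 'n) ring_scheme \<Rightarrow> ('g, 'm) monoid_scheme \<Rightarrow> ('g \<Rightarrow> 'g \<Rightarrow> 'r) \<Rightarrow>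
    (('g \<Rightarrow> 'r) \<Rightarrow> ('g \<Rightarrow> 'r)) \<Rightarrow> bool" where
  "R_derivation R G \<alpha> d \<longleftrightarrow>
    (let A = twisted_group_ring R G \<alpha> in
      derivation A d \<and>
      (\<forall>r\<in>carrier R. d (r \<odot>\<^bsub>A\<^esub> basis_elt R G \<one>\<^bsub>G\<^esub>) = \<zero>\<^bsub>A\<^esub>))"

definition extends ::
  "('r, 'n) ring_scheme \<Rightarrow> ('g, 'm) monoid_scheme \<Rightarrow> ('s \<Rightarrow> 'g) \<Rightarrow> 's set \<Rightarrow>
    ('s \<Rightarrow> 'g \<Rightarrow> 'r) \<Rightarrow> (('g \<Rightarrow> 'r) \<Rightarrow> ('g \<Rightarrow> 'r)) \<Rightarrow> bool" where
  "extends R G \<iota> S f d \<longleftrightarrow> (\<forall>s\<in>S. d (basis_elt R G (\<iota> s)) = f s)"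


section \<open>The map \<open>f\<^sup>*\<close>\<close>

definition beta ::
  "('r, 'n) ring_scheme \<Rightarrow> ('g, 'm) monoid_scheme \<Rightarrow> ('g \<Rightarrow> 'g \<Rightarrow> 'r) \<Rightarrow> ('s \<Rightarrow> 'g) \<Rightarrow>
    's letter list \<Rightarrow> 'r" where
  "beta R G \<alpha> \<iota> w =
    (\<Otimes>\<^bsub>R\<^esub>i\<in>{..<length w - 1}. \<alpha> (letter_val G \<iota> (w ! i)) (word_val G \<iota> (drop (Suc i) w)))"

definition bar_prod ::
  "('r, 'n) ring_scheme \<Rightarrow> ('g, 'm) monoid_scheme \<Rightarrow> ('g \<Rightarrow> 'g \<Rightarrow> 'r) \<Rightarrow> ('s \<Rightarrow> 'g) \<Rightarrow>
    's letter list \<Rightarrow> 'g \<Rightarrow> 'r" where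
  "bar_prod R G \<alpha> \<iota> w =
    (let A = twisted_group_ring R G \<alpha> in
      foldr (\<otimes>\<^bsub>A\<^esub>) (map (\<lambda>x. basis_elt R G (letter_val G \<iota> x)) w) \<one>\<^bsub>A\<^esub>)"

primrec fstar_letter ::
  "('r, 'n) ring_scheme \<Rightarrow> ('g, 'm) monoid_scheme \<Rightarrow> ('g \<Rightarrow> 'g \<Rightarrow> 'r) \<Rightarrow> ('s \<Rightarrow> 'g) \<Rightarrow>
    ('s \<Rightarrow> 'g \<Rightarrow> 'r) \<Rightarrow> 's letter \<Rightarrow> 'g \<Rightarrow> 'r" where
  "fstar_letter R G \<alpha> \<iota> f (Gen s) = f s"
| "fstar_letter R G \<alpha> \<iota> f (Inv s) =
    (let A = twisted_group_ring R G \<alpha>; b = basis_elt R G (inv\<^bsub>G\<^esub> (\<iota> s)) in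
      \<ominus>\<^bsub>A\<^esub> (inv\<^bsub>R\<^esub> (\<alpha> (inv\<^bsub>G\<^esub> (\<iota> s)) (\<iota> s)) \<odot>\<^bsub>A\<^esub> (b \<otimes>\<^bsub>A\<^esub> f s \<otimes>\<^bsub>A\<^esub> b)))"

definition fstar ::
  "('r, 'n) ring_scheme \<Rightarrow> ('g, 'm) monoid_scheme \<Rightarrow> ('g \<Rightarrow> 'g \<Rightarrow> 'r) \<Rightarrow> ('s \<Rightarrow> 'g) \<Rightarrow>
    ('s \<Rightarrow> 'g \<Rightarrow> 'r) \<Rightarrow> 's letter list \<Rightarrow> 'g \<Rightarrow> 'r" where
  "fstar R G \<alpha> \<iota> f w =
    (let A = twisted_group_ring R G \<alpha> in
      case w of
        [] \<Rightarrow> \<zero>\<^bsub>A\<^esub>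
      | [x] \<Rightarrow> fstar_letter R G \<alpha> \<iota> f x
      | _ \<Rightarrow>
          inv\<^bsub>R\<^esub> (beta R G \<alpha> \<iota> w) \<odot>\<^bsub>A\<^esub>
          (\<Oplus>\<^bsub>A\<^esub>i\<in>{..<length w}.
            bar_prod R G \<alpha> \<iota> (take i w) \<otimes>\<^bsub>A\<^esub>
            fstar_letter R G \<alpha> \<iota> f (w ! i) \<otimes>\<^bsub>A\<^esub>
            bar_prod R G \<alpha> \<iota> (drop (Suc i) w)))"

end

theory Submission
  imports Defs
begin

text \<open>
  On words, \<open>f\<^sup>*\<close> is a twisted version of the Fox derivative. Everything rests on its Leibniz rule
  \<open>\<alpha>(u, v) f\<^sup>*(u v) = f\<^sup>*(u) bar(v) + bar(u) f\<^sup>*(v)\<close> for arbitrary words \<open>u\<close> and \<open>v\<close>, where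
  \<open>\<alpha>\<close> and \<open>bar\<close> are evaluated at the elements of \<open>G\<close> that the words represent (lemma
  \<open>fs_append\<close>). It follows from the recursion \<open>fs_Cons\<close>, the corresponding identity with a single
  letter in place of \<open>u\<close>, by the cocycle identity.

  Uniqueness and the formula: an \<open>R\<close>-derivation is \<open>R\<close>-linear, hence determined by its values on the
  basis. If it extends \<open>f\<close>, the Leibniz rule forces its value on inverses of generators, and
  then it satisfies the same recursion along words as \<open>f\<^sup>*\<close>; so it sends \<open>bar(w)\<close> to
  \<open>f\<^sup>*(w)\<close> (\<open>derivation_word\<close>). In particular \<open>f\<^sup>*(t) = d(bar 1) = 0\<close> for a relator \<open>t\<close>.

  Existence: call a word good if it has value \<open>1\<close> in \<open>G\<close> and \<open>f\<^sup>*\<close> vanishes on it. By the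
  Leibniz rule, \<open>f\<^sup>*\<close> is invariant under free cancellation (\<open>free_rel_wval_fs\<close>) and the good words
  give a normal subgroup of the free group. If all relators are good, this subgroup contains their
  normal closure, which is the kernel of the evaluation in \<open>G\<close>; so all words with value \<open>1\<close> are good
  (\<open>fs_kernel\<close>). Since a good word can be deleted from the front of any word without changing
  \<open>f\<^sup>*\<close>, the value \<open>f\<^sup>*(w)\<close> depends only on the element represented by \<open>w\<close>
  (\<open>fs_well_defined\<close>). Thus \<open>f\<^sup>*\<close> descends to the basis of the twisted group ring, and the Leibniz
  rule for words is exactly what makes its linear extension a derivation
  (\<open>lin_ext_R_derivation\<close>).
\<close>

section \<open>Words and presentations\<close>

abbreviation letters :: "'s set \<Rightarrow> 's letter set" where
  "letters S \<equiv> Gen ` S \<union> Inv ` S"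

lemma words_simps [simp]:
  "[] \<in> words S"
  "x # w \<in> words S \<longleftrightarrow> x \<in> letters S \<and> w \<in> words S"
  "u @ v \<in> words S \<longleftrightarrow> u \<in> words S \<and> v \<in> words S"
  by (auto simp: words_def)

lemma letter_inv_letters [simp]: "x \<in> letters S \<Longrightarrow> letter_inv x \<in> letters S"
  by (cases x) auto

lemma letter_inv_inv [simp]: "letter_inv (letter_inv x) = x"
  by (cases x) auto

definition word_inv :: "'s letter list \<Rightarrow> 's letter list" where
  "word_inv w = rev (map letter_inv w)"

lemma word_inv_Nil [simp]: "word_inv [] = []"
  by (simp add: word_inv_def)

lemma word_inv_Cons: "word_inv (x # w) = word_inv w @ [letter_inv x]"
  by (simp add: word_inv_def)

lemma word_inv_words [simp]: "w \<in> words S \<Longrightarrow> word_inv w \<in> words S"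
  by (induction w) (simp_all add: word_inv_Cons del: Un_iff)

lemma word_inv_word_inv [simp]: "word_inv (word_inv w) = w"
  by (simp add: word_inv_def rev_map comp_def)

abbreviation word_class :: "'s set \<Rightarrow> 's letter list \<Rightarrow> 's letter list set" where
  "word_class S w \<equiv> free_rel S `` {w}"

lemma free_rel_words: "(u, v) \<in> free_rel S \<Longrightarrow> u \<in> words S \<and> v \<in> words S"
  by (induction rule: free_rel.induct) auto

lemma equiv_free_rel: "equiv (words S) (free_rel S)"
proof (rule equivI)
  show "free_rel S \<subseteq> words S \<times> words S"
    using free_rel_words by auto
  show "refl_on (words S) (free_rel S)"
    by (auto simp: refl_on_def intro: free_rel.refl dest: free_rel_words)
qed (auto intro: symI transI free_rel.sym free_rel.trans)

lemma free_rel_append_left: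
  "(u, v) \<in> free_rel S \<Longrightarrow> w \<in> words S \<Longrightarrow> (w @ u, w @ v) \<in> free_rel S"
proof (induction rule: free_rel.induct)
  case (cancel u x v)
  then show ?case using free_rel.cancel[of "w @ u" x v S] by simp
qed (auto intro: free_rel.refl free_rel.sym free_rel.trans)

lemma free_rel_append_right:
  "(u, v) \<in> free_rel S \<Longrightarrow> w \<in> words S \<Longrightarrow> (u @ w, v @ w) \<in> free_rel S"
proof (induction rule: free_rel.induct)
  case (cancel u x v)
  then show ?case using free_rel.cancel[of u x "v @ w" S] by simp
qed (auto intro: free_rel.refl free_rel.sym free_rel.trans)

lemma free_rel_word_inv: "w \<in> words S \<Longrightarrow> (w @ word_inv w, []) \<in> free_rel S"
proof (induction w)
  case Nil
  show ?case by (simp add: free_rel.refl)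
next
  case (Cons x w)
  then have x: "x \<in> letters S" and w: "w \<in> words S" by simp_all
  have "([x] @ (w @ word_inv w) @ [letter_inv x], [x] @ [] @ [letter_inv x]) \<in> free_rel S"
    using Cons.IH[OF w] x letter_inv_letters[OF x]
    by (intro free_rel_append_left free_rel_append_right) simp_all
  moreover have "([] @ [x, letter_inv x] @ [], [] @ []) \<in> free_rel S"
    using x letter_inv_letters[OF x] by (intro free_rel.cancel) simp
  ultimately show ?case
    by (auto simp: word_inv_Cons intro: free_rel.trans)
qed

lemma free_group_carrier: "U \<in> carrier (free_group S) \<longleftrightarrow> (\<exists>u\<in>words S. U = word_class S u)"
  by (auto simp: free_group_def quotient_def)

lemma word_class_closed [simp]: "w \<in> words S \<Longrightarrow> word_class S w \<in> carrier (free_group S)"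
  by (auto simp: free_group_carrier)

lemma word_class_eq_iff:
  "u \<in> words S \<Longrightarrow> v \<in> words S \<Longrightarrow> word_class S u = word_class S v \<longleftrightarrow> (u, v) \<in> free_rel S"
  using eq_equiv_class_iff[OF equiv_free_rel] .

text \<open>
  Passing through representatives is legitimate because free equivalence is a congruence for
  concatenation.
\<close>

lemma free_group_mult:
  assumes "u \<in> words S" "v \<in> words S"
  shows "word_class S u \<otimes>\<^bsub>free_group S\<^esub> word_class S v = word_class S (u @ v)"
proof -
  have "congruent2 (free_rel S) (free_rel S) (\<lambda>u v. word_class S (u @ v))"
  proof (rule congruent2I[OF equiv_free_rel equiv_free_rel])
    show "word_class S (u @ w) = word_class S (v @ w)"
      if "w \<in> words S" "(u, v) \<in> free_rel S" for u v w
      using that free_rel_words[OF that(2)]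
      by (subst word_class_eq_iff) (simp_all add: free_rel_append_right)
    show "word_class S (w @ u) = word_class S (w @ v)"
      if "w \<in> words S" "(u, v) \<in> free_rel S" for u v w
      using that free_rel_words[OF that(2)]
      by (subst word_class_eq_iff) (simp_all add: free_rel_append_left)
  qed
  from UN_equiv_class2[OF equiv_free_rel equiv_free_rel this assms]
  show ?thesis by (simp add: free_group_def)
qed

lemma free_group_one: "\<one>\<^bsub>free_group S\<^esub> = word_class S []"
  by (simp add: free_group_def)

lemma group_free_group: "group (free_group S)"
proof (rule groupI)
  show "\<exists>V\<in>carrier (free_group S). V \<otimes>\<^bsub>free_group S\<^esub> U = \<one>\<^bsub>free_group S\<^esub>"
    if U: "U \<in> carrier (free_group S)" for U
  proof -
    obtain u where u: "u \<in> words S" "U = word_class S u"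
      using U unfolding free_group_carrier by blast
    have "word_class S (word_inv u) \<otimes>\<^bsub>free_group S\<^esub> U = \<one>\<^bsub>free_group S\<^esub>"
      using u free_rel_word_inv[of "word_inv u" S]
      by (simp add: free_group_mult free_group_one word_class_eq_iff)
    with u show ?thesis by auto
  qed
qed (auto simp: free_group_carrier free_group_mult free_group_one)

lemma free_group_inv:
  assumes "w \<in> words S"
  shows "inv\<^bsub>free_group S\<^esub> word_class S w = word_class S (word_inv w)"
proof (rule group.inv_equality[OF group_free_group])
  show "word_class S (word_inv w) \<otimes>\<^bsub>free_group S\<^esub> word_class S w = \<one>\<^bsub>free_group S\<^esub>"
    using assms free_rel_word_inv[of "word_inv w" S]
    by (simp add: free_group_mult free_group_one word_class_eq_iff)
qed (use assms in simp_all)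

text \<open>
  The intersection is over a nonempty family, since the whole group is a normal subgroup that
  contains every subset.
\<close>

lemma (in group) normal_closure_normal:
  assumes "B \<subseteq> carrier G"
  shows "normal_closure G B \<lhd> G"
  unfolding normal_inv_iff
proof (intro conjI ballI)
  show "subgroup (normal_closure G B) G"
    unfolding normal_closure_def
  proof (rule subgroups_Inter)
    have "carrier G \<lhd> G"
      by (simp add: normal_inv_iff subgroup_self)
    with assms show "{N. N \<lhd> G \<and> B \<subseteq> N} \<noteq> {}" by blast
  qed (auto simp: normal_inv_iff)
  show "x \<otimes> h \<otimes> inv x \<in> normal_closure G B"
    if "x \<in> carrier G" "h \<in> normal_closure G B" for x h
    using that by (auto simp: normal_closure_def normal_inv_iff)
qed

lemma word_val_Nil [simp]: "word_val G \<iota> [] = \<one>\<^bsub>G\<^esub>"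
  and word_val_Cons [simp]: "word_val G \<iota> (x # w) = letter_val G \<iota> x \<otimes>\<^bsub>G\<^esub> word_val G \<iota> w"
  by (simp_all add: word_val_def)

text \<open>
  The isomorphism in the definition of a presentation, composed with the two projections
  (words onto the free group, the free group onto its quotient), is evaluation of words in \<open>G\<close>:
  both are multiplicative and agree on letters. Surjectivity and injectivity of the isomorphism
  then say that every element of \<open>G\<close> is the value of a word, and that a word has value \<open>1\<close>
  exactly when its class lies in the normal closure of the relators.
\<close>

lemma
  assumes G: "group G" and pres: "presentation G \<iota> S T"
  shows presentation_generator_closed: "\<And>s. s \<in> S \<Longrightarrow> \<iota> s \<in> carrier G"
    and presentation_word_exists: "\<And>g. g \<in> carrier G \<Longrightarrow> \<exists>w\<in>words S. word_val G \<iota> w = g"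
    and presentation_kernel: "\<And>w. w \<in> words S \<Longrightarrow> word_val G \<iota> w = \<one>\<^bsub>G\<^esub> \<Longrightarrow>
      word_class S w \<in> relator_subgroup S T"
    and presentation_relator_val: "\<And>t. t \<in> T \<Longrightarrow> word_val G \<iota> t = \<one>\<^bsub>G\<^esub>"
proof -
  interpret F: group "free_group S" by (rule group_free_group)
  interpret G: group G by (rule G)
  let ?F = "free_group S" and ?N = "relator_subgroup S T"
  from pres have T: "T \<subseteq> words S" by (simp add: presentation_def)
  from pres obtain \<phi> where \<phi>: "\<phi> \<in> iso (presented_group S T) G"
    and \<phi>_gen: "\<And>s. s \<in> S \<Longrightarrow> \<phi> (?N #>\<^bsub>?F\<^esub> word_class S [Gen s]) = \<iota> s"
    by (auto simp: presentation_def)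
  have relators: "word_class S ` T \<subseteq> carrier ?F"
    using T by auto
  have N: "?N \<lhd> ?F"
    unfolding relator_subgroup_def by (rule F.normal_closure_normal[OF relators])
  interpret N: normal ?N ?F by (rule N)
  define \<Phi> where "\<Phi> U = \<phi> (?N #>\<^bsub>?F\<^esub> U)" for U
  have coset: "?N #>\<^bsub>?F\<^esub> U \<in> carrier (presented_group S T)" if "U \<in> carrier ?F" for U
    using that by (auto simp: presented_group_def FactGroup_def RCOSETS_def)
  have hom: "\<Phi> \<in> hom ?F G"
    using hom_compose[OF N.r_coset_hom_Mod, of \<phi> G] \<phi>
    by (simp add: \<Phi>_def[abs_def] iso_def presented_group_def comp_def)
  interpret \<Phi>: group_hom ?F G \<Phi>
    by (rule group_hom.intro[OF _ _ group_hom_axioms.intro])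
      (fact F.group_axioms G hom)+
  have letter: "\<Phi> (word_class S [x]) = letter_val G \<iota> x" if x: "x \<in> letters S" for x
  proof (cases x)
    case (Gen s)
    then show ?thesis using x \<phi>_gen by (auto simp: \<Phi>_def)
  next
    case (Inv s)
    then have s: "s \<in> S" using x by auto
    then have "word_class S [x] = inv\<^bsub>?F\<^esub> word_class S [Gen s]"
      using Inv by (simp add: free_group_inv word_inv_Cons)
    then show ?thesis using s Inv \<phi>_gen by (simp add: \<Phi>.hom_inv \<Phi>_def[symmetric])
  qed
  have val: "\<Phi> (word_class S w) = word_val G \<iota> w" if "w \<in> words S" for w
    using that
  proof (induction w)
    case Nil
    show ?case by (simp add: free_group_one[symmetric])
  next
    case (Cons x w)
    then have "\<Phi> (word_class S [x] \<otimes>\<^bsub>?F\<^esub> word_class S w) =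
        letter_val G \<iota> x \<otimes>\<^bsub>G\<^esub> word_val G \<iota> w"
      by (subst \<Phi>.hom_mult) (simp_all add: letter)
    then show ?case using Cons.prems by (simp add: free_group_mult)
  qed
  have bij: "bij_betw \<phi> (carrier (presented_group S T)) (carrier G)"
    using \<phi> by (simp add: iso_def)
  have "\<Phi> ` carrier ?F = \<phi> ` carrier (presented_group S T)"
    by (auto simp: \<Phi>_def presented_group_def FactGroup_def RCOSETS_def)
  with bij have surj: "\<Phi> ` carrier ?F = carrier G"
    by (simp add: bij_betw_def)
  have ker: "U \<in> ?N" if U: "U \<in> carrier ?F" "\<Phi> U = \<one>\<^bsub>G\<^esub>" for U
  proof -
    have "\<phi> (?N #>\<^bsub>?F\<^esub> U) = \<phi> (?N #>\<^bsub>?F\<^esub> \<one>\<^bsub>?F\<^esub>)"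
      using U \<Phi>.hom_one by (simp add: \<Phi>_def)
    then have "?N #>\<^bsub>?F\<^esub> U = ?N #>\<^bsub>?F\<^esub> \<one>\<^bsub>?F\<^esub>"
      using bij coset U by (auto simp: bij_betw_def inj_on_def)
    then show ?thesis
      using U F.rcos_self[OF U(1) N.subgroup_axioms] by (simp add: F.coset_mult_one N.subset)
  qed
  show "\<iota> s \<in> carrier G" if "s \<in> S" for s
    using \<Phi>.hom_closed[of "word_class S [Gen s]"] that letter[of "Gen s"] by simp
  show "\<exists>w\<in>words S. word_val G \<iota> w = g" if g: "g \<in> carrier G" for g
  proof -
    obtain U where "U \<in> carrier ?F" "g = \<Phi> U"
      using g surj by blast
    then show ?thesis using val unfolding free_group_carrier by metis
  qed
  show "word_class S w \<in> ?N" if "w \<in> words S" "word_val G \<iota> w = \<one>\<^bsub>G\<^esub>" for w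
    using that by (intro ker) (simp_all add: val)
  show "word_val G \<iota> t = \<one>\<^bsub>G\<^esub>" if t: "t \<in> T" for t
  proof -
    have "word_class S t \<in> ?N"
      using t by (auto simp: relator_subgroup_def normal_closure_def)
    then have "\<Phi> (word_class S t) = \<Phi> \<one>\<^bsub>?F\<^esub>"
      unfolding \<Phi>_def using F.coset_join2[OF _ N.subgroup_axioms] N.subset
      by (simp add: F.coset_mult_one subset_iff)
    then show ?thesis using t T by (simp add: val subset_iff)
  qed
qed

text \<open>
  An induction principle for the words that are trivial in \<open>G\<close>. The classes of the words
  satisfying \<open>P\<close> form a normal subgroup of the free group that contains the relators, hence
  contain their normal closure.
\<close>

lemma presentation_kernel_induct [consumes 4, case_names Nil relator free_rel append inverse conj]:
  assumes "group G" "presentation G \<iota> S T" "w \<in> words S" "word_val G \<iota> w = \<one>\<^bsub>G\<^esub>"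
    and Nil: "P []"
    and relator: "\<And>t. t \<in> T \<Longrightarrow> P t"
    and free_rel: "\<And>u v. (u, v) \<in> free_rel S \<Longrightarrow> P u \<Longrightarrow> P v"
    and append: "\<And>u v. u \<in> words S \<Longrightarrow> v \<in> words S \<Longrightarrow> P u \<Longrightarrow> P v \<Longrightarrow> P (u @ v)"
    and inverse: "\<And>u. u \<in> words S \<Longrightarrow> P u \<Longrightarrow> P (word_inv u)"
    and conj: "\<And>u v. u \<in> words S \<Longrightarrow> v \<in> words S \<Longrightarrow> P u \<Longrightarrow> P (v @ u @ word_inv v)"
  shows "P w"
proof -
  interpret F: group "free_group S" by (rule group_free_group)
  let ?M = "{word_class S u | u. u \<in> words S \<and> P u}"
  have "?M \<lhd> free_group S"
    unfolding F.normal_inv_iff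
  proof (intro conjI ballI)
    show "subgroup ?M (free_group S)"
    proof (rule F.subgroupI)
      show "?M \<noteq> {}" using Nil words_simps(1) by blast
      show "inv\<^bsub>free_group S\<^esub> U \<in> ?M" if U: "U \<in> ?M" for U
      proof -
        obtain u where "u \<in> words S" "P u" "U = word_class S u"
          using U by blast
        then show ?thesis using inverse[of u] free_group_inv[of u S] word_inv_words by blast
      qed
      show "U \<otimes>\<^bsub>free_group S\<^esub> V \<in> ?M" if UV: "U \<in> ?M" "V \<in> ?M" for U V
      proof -
        obtain u v where "u \<in> words S" "P u" "U = word_class S u"
          "v \<in> words S" "P v" "V = word_class S v"
          using UV by blast
        then show ?thesis
          using append[of u v] free_group_mult[of u S v] words_simps(3) by blast
      qed
    qed auto
    show "V \<otimes>\<^bsub>free_group S\<^esub> U \<otimes>\<^bsub>free_group S\<^esub> inv\<^bsub>free_group S\<^esub> V \<in> ?M"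
      if V: "V \<in> carrier (free_group S)" and U: "U \<in> ?M" for U V
    proof -
      obtain u v where "u \<in> words S" "P u" "U = word_class S u" "v \<in> words S" "V = word_class S v"
        using U V unfolding free_group_carrier by blast
      moreover from this have "V \<otimes>\<^bsub>free_group S\<^esub> U \<otimes>\<^bsub>free_group S\<^esub> inv\<^bsub>free_group S\<^esub> V =
          word_class S (v @ u @ word_inv v)"
        by (simp add: free_group_mult free_group_inv)
      moreover have "v @ u @ word_inv v \<in> words S"
        using calculation by simp
      ultimately show ?thesis
        using conj[of u v] by blast
    qed
  qed
  moreover have "word_class S ` T \<subseteq> ?M"
    using relator assms(2) by (auto simp: presentation_def)
  ultimately have "relator_subgroup S T \<subseteq> ?M"
    by (auto simp: relator_subgroup_def normal_closure_def)
  moreover have "word_class S w \<in> relator_subgroup S T"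
    using presentation_kernel[OF assms(1-4)] .
  ultimately obtain u where u: "word_class S w = word_class S u" "u \<in> words S" "P u"
    by blast
  then have "(u, w) \<in> free_rel S"
    using assms(3) by (simp add: word_class_eq_iff[symmetric])
  then show ?thesis using u(3) free_rel by blast
qed

section \<open>The module underlying a twisted group ring\<close>

locale twisted = R: cring R + G: group G
  for R :: "('r, 'n) ring_scheme" and G :: "('g, 'm) monoid_scheme" +
  fixes \<alpha> :: "'g \<Rightarrow> 'g \<Rightarrow> 'r"
  assumes cocycle: "normalized_cocycle R G \<alpha>"
begin

abbreviation A :: "('r, 'g \<Rightarrow> 'r) module" where
  "A \<equiv> twisted_group_ring R G \<alpha>"

abbreviation bar :: "'g \<Rightarrow> 'g \<Rightarrow> 'r" where
  "bar \<equiv> basis_elt R G"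

lemma A_carrier: "carrier A = {a \<in> carrier G \<rightarrow>\<^sub>E carrier R. finite (supp R G a)}"
  and A_mult: "a \<otimes>\<^bsub>A\<^esub> b = (\<lambda>k\<in>carrier G. finsum R (\<lambda>(g, h). a g \<otimes>\<^bsub>R\<^esub> b h \<otimes>\<^bsub>R\<^esub> \<alpha> g h)
      {(g, h) \<in> supp R G a \<times> supp R G b. g \<otimes>\<^bsub>G\<^esub> h = k})"
  and A_one: "\<one>\<^bsub>A\<^esub> = bar \<one>\<^bsub>G\<^esub>"
  and A_zero: "\<zero>\<^bsub>A\<^esub> = (\<lambda>k\<in>carrier G. \<zero>\<^bsub>R\<^esub>)"
  and A_add: "a \<oplus>\<^bsub>A\<^esub> b = (\<lambda>k\<in>carrier G. a k \<oplus>\<^bsub>R\<^esub> b k)"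
  and A_smult: "r \<odot>\<^bsub>A\<^esub> a = (\<lambda>k\<in>carrier G. r \<otimes>\<^bsub>R\<^esub> a k)"
  by (simp_all add: twisted_group_ring_def)

lemma alpha_Units [simp]: "x \<in> carrier G \<Longrightarrow> y \<in> carrier G \<Longrightarrow> \<alpha> x y \<in> Units R"
  using cocycle by (simp add: normalized_cocycle_def)

lemma alpha_closed [simp]: "x \<in> carrier G \<Longrightarrow> y \<in> carrier G \<Longrightarrow> \<alpha> x y \<in> carrier R"
  by (simp add: R.Units_closed)

lemma alpha_cocycle:
  "x \<in> carrier G \<Longrightarrow> y \<in> carrier G \<Longrightarrow> z \<in> carrier G \<Longrightarrow>
    \<alpha> x y \<otimes>\<^bsub>R\<^esub> \<alpha> (x \<otimes>\<^bsub>G\<^esub> y) z = \<alpha> y z \<otimes>\<^bsub>R\<^esub> \<alpha> x (y \<otimes>\<^bsub>G\<^esub> z)"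
  using cocycle by (simp add: normalized_cocycle_def)

lemma alpha_one [simp]: "g \<in> carrier G \<Longrightarrow> \<alpha> \<one>\<^bsub>G\<^esub> g = \<one>\<^bsub>R\<^esub>" "g \<in> carrier G \<Longrightarrow> \<alpha> g \<one>\<^bsub>G\<^esub> = \<one>\<^bsub>R\<^esub>"
  using cocycle by (simp_all add: normalized_cocycle_def)

lemma alpha_inv_commute:
  assumes "g \<in> carrier G"
  shows "\<alpha> (inv\<^bsub>G\<^esub> g) g = \<alpha> g (inv\<^bsub>G\<^esub> g)"
  using alpha_cocycle[of g "inv\<^bsub>G\<^esub> g" g] assms by simp

lemma A_carrier_iff:
  "a \<in> carrier A \<longleftrightarrow> a \<in> carrier G \<rightarrow>\<^sub>E carrier R \<and> finite (supp R G a)"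
  by (simp add: A_carrier)

lemma coeff_closed [simp]: "a \<in> carrier A \<Longrightarrow> g \<in> carrier G \<Longrightarrow> a g \<in> carrier R"
  by (auto simp: A_carrier_iff)

lemma finite_supp [simp]: "a \<in> carrier A \<Longrightarrow> finite (supp R G a)"
  by (simp add: A_carrier_iff)

lemma supp_subset: "supp R G a \<subseteq> carrier G"
  by (auto simp: supp_def)

lemma in_supp_iff: "g \<in> supp R G a \<longleftrightarrow> g \<in> carrier G \<and> a g \<noteq> \<zero>\<^bsub>R\<^esub>"
  by (simp add: supp_def)

lemma A_eqI:
  assumes "a \<in> carrier A" "b \<in> carrier A" "\<And>g. g \<in> carrier G \<Longrightarrow> a g = b g"
  shows "a = b"
  using assms by (auto simp: A_carrier_iff intro: PiE_ext)

lemma A_memI: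
  assumes "finite F" "\<And>g. g \<in> carrier G \<Longrightarrow> h g \<in> carrier R"
    and "\<And>g. g \<in> carrier G \<Longrightarrow> g \<notin> F \<Longrightarrow> h g = \<zero>\<^bsub>R\<^esub>"
  shows "(\<lambda>g\<in>carrier G. h g) \<in> carrier A"
proof -
  have "supp R G (\<lambda>g\<in>carrier G. h g) \<subseteq> F"
    using assms(3) by (fastforce simp: in_supp_iff)
  then show ?thesis
    using assms by (auto simp: A_carrier_iff intro: finite_subset)
qed

lemma bar_coeff: "h \<in> carrier G \<Longrightarrow> bar g h = (if h = g then \<one>\<^bsub>R\<^esub> else \<zero>\<^bsub>R\<^esub>)"
  by (simp add: basis_elt_def)

lemma zero_coeff: "g \<in> carrier G \<Longrightarrow> \<zero>\<^bsub>A\<^esub> g = \<zero>\<^bsub>R\<^esub>"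
  by (simp add: A_zero)

lemma add_coeff: "g \<in> carrier G \<Longrightarrow> (a \<oplus>\<^bsub>A\<^esub> b) g = a g \<oplus>\<^bsub>R\<^esub> b g"
  by (simp add: A_add)

lemma smult_coeff: "g \<in> carrier G \<Longrightarrow> (r \<odot>\<^bsub>A\<^esub> a) g = r \<otimes>\<^bsub>R\<^esub> a g"
  by (simp add: A_smult)

lemma bar_closed [simp]: "bar g \<in> carrier A"
  unfolding basis_elt_def by (rule A_memI[of "{g}"]) auto

lemma A_zero_closed: "\<zero>\<^bsub>A\<^esub> \<in> carrier A"
proof -
  have "(\<lambda>g\<in>carrier G. \<zero>\<^bsub>R\<^esub>) \<in> carrier A"
    by (rule A_memI[of "{}"]) auto
  then show ?thesis by (simp add: A_zero)
qed

lemma A_add_closed: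
  assumes "a \<in> carrier A" "b \<in> carrier A"
  shows "a \<oplus>\<^bsub>A\<^esub> b \<in> carrier A"
proof -
  have "(\<lambda>g\<in>carrier G. a g \<oplus>\<^bsub>R\<^esub> b g) \<in> carrier A"
    using assms by (intro A_memI[of "supp R G a \<union> supp R G b"]) (auto simp: in_supp_iff)
  then show ?thesis by (simp add: A_add)
qed

lemma A_smult_closed:
  assumes "r \<in> carrier R" "a \<in> carrier A"
  shows "r \<odot>\<^bsub>A\<^esub> a \<in> carrier A"
proof -
  have "(\<lambda>g\<in>carrier G. r \<otimes>\<^bsub>R\<^esub> a g) \<in> carrier A"
    using assms by (intro A_memI[of "supp R G a"]) (auto simp: in_supp_iff)
  then show ?thesis by (simp add: A_smult)
qed

lemma abelian_group_A: "abelian_group A"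
proof (rule abelian_groupI)
  show "\<exists>y\<in>carrier A. y \<oplus>\<^bsub>A\<^esub> x = \<zero>\<^bsub>A\<^esub>" if x: "x \<in> carrier A" for x
  proof
    show *: "(\<ominus>\<^bsub>R\<^esub> \<one>\<^bsub>R\<^esub>) \<odot>\<^bsub>A\<^esub> x \<in> carrier A"
      using x by (simp add: A_smult_closed)
    show "(\<ominus>\<^bsub>R\<^esub> \<one>\<^bsub>R\<^esub>) \<odot>\<^bsub>A\<^esub> x \<oplus>\<^bsub>A\<^esub> x = \<zero>\<^bsub>A\<^esub>"
      by (rule A_eqI)
        (use x * in \<open>simp_all add: A_add_closed A_zero_closed add_coeff smult_coeff zero_coeff
           R.l_minus R.l_neg\<close>)
  qed
qed (auto intro!: A_add_closed A_zero_closed A_eqI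
       simp: add_coeff zero_coeff R.a_ac)

sublocale M: module R A
proof (rule moduleI)
  show "cring R" ..
  show "abelian_group A" by (rule abelian_group_A)
  show "(r \<oplus>\<^bsub>R\<^esub> s) \<odot>\<^bsub>A\<^esub> x = r \<odot>\<^bsub>A\<^esub> x \<oplus>\<^bsub>A\<^esub> s \<odot>\<^bsub>A\<^esub> x"
    if "r \<in> carrier R" "s \<in> carrier R" "x \<in> carrier A" for r s x
    using that by (intro A_eqI) (simp_all add: A_add_closed A_smult_closed add_coeff smult_coeff R.l_distr)
  show "r \<odot>\<^bsub>A\<^esub> (x \<oplus>\<^bsub>A\<^esub> y) = r \<odot>\<^bsub>A\<^esub> x \<oplus>\<^bsub>A\<^esub> r \<odot>\<^bsub>A\<^esub> y"
    if "r \<in> carrier R" "x \<in> carrier A" "y \<in> carrier A" for r x y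
    using that by (intro A_eqI) (simp_all add: A_add_closed A_smult_closed add_coeff smult_coeff R.r_distr)
  show "(r \<otimes>\<^bsub>R\<^esub> s) \<odot>\<^bsub>A\<^esub> x = r \<odot>\<^bsub>A\<^esub> (s \<odot>\<^bsub>A\<^esub> x)"
    if "r \<in> carrier R" "s \<in> carrier R" "x \<in> carrier A" for r s x
    using that by (intro A_eqI) (simp_all add: A_smult_closed smult_coeff R.m_assoc)
  show "\<one>\<^bsub>R\<^esub> \<odot>\<^bsub>A\<^esub> x = x" if "x \<in> carrier A" for x
    using that by (intro A_eqI) (simp_all add: A_smult_closed smult_coeff)
qed (rule A_smult_closed)

text \<open>
  Every element is a finite sum of monomials. As multiplication is bilinear, this reduces the ring
  axioms and the Leibniz rule to monomials, where they are statements about \<open>\<alpha>\<close>.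
\<close>

lemma A_induct [consumes 1, case_names zero monomial add]:
  assumes a: "a \<in> carrier A"
    and zero: "P \<zero>\<^bsub>A\<^esub>"
    and monomial: "\<And>r g. r \<in> carrier R \<Longrightarrow> g \<in> carrier G \<Longrightarrow> P (r \<odot>\<^bsub>A\<^esub> bar g)"
    and add: "\<And>a b. a \<in> carrier A \<Longrightarrow> b \<in> carrier A \<Longrightarrow> P a \<Longrightarrow> P b \<Longrightarrow> P (a \<oplus>\<^bsub>A\<^esub> b)"
  shows "P a"
proof -
  have "P b" if "finite F" "b \<in> carrier A" "supp R G b \<subseteq> F" "F \<subseteq> carrier G" for F b
    using that
  proof (induction F arbitrary: b rule: finite_induct)
    case empty
    then have "b = \<zero>\<^bsub>A\<^esub>"
      by (intro A_eqI) (auto simp: zero_coeff in_supp_iff)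
    with zero show ?case by simp
  next
    case (insert g F)
    have g: "g \<in> carrier G" using insert.prems by simp
    \<comment> \<open>Split off the monomial at \<open>g\<close>; the rest is supported in \<open>F\<close>.\<close>
    define c where "c = (\<lambda>h\<in>carrier G. if h = g then \<zero>\<^bsub>R\<^esub> else b h)"
    have c: "c \<in> carrier A"
      unfolding c_def using insert.prems
      by (intro A_memI[of "supp R G b"]) (auto simp: in_supp_iff)
    have "supp R G c \<subseteq> F"
      using insert.prems by (auto simp: in_supp_iff c_def split: if_splits)
    with insert c have "P c" by simp
    moreover have "b = b g \<odot>\<^bsub>A\<^esub> bar g \<oplus>\<^bsub>A\<^esub> c"
      by (rule A_eqI) (use insert.prems g c in \<open>auto simp: add_coeff smult_coeff bar_coeff c_def\<close>)
    ultimately show ?case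
      using add[OF _ c monomial[of "b g" g]] insert.prems g by (metis M.smult_closed bar_closed coeff_closed monomial)
  qed
  from this[of "supp R G a" a] a show ?thesis
    by (simp add: supp_subset)
qed

lemma smult_cancel:
  assumes "u \<in> Units R" "a \<in> carrier A" "b \<in> carrier A" "u \<odot>\<^bsub>A\<^esub> a = u \<odot>\<^bsub>A\<^esub> b"
  shows "a = b"
proof -
  have "inv\<^bsub>R\<^esub> u \<odot>\<^bsub>A\<^esub> (u \<odot>\<^bsub>A\<^esub> a) = inv\<^bsub>R\<^esub> u \<odot>\<^bsub>A\<^esub> (u \<odot>\<^bsub>A\<^esub> b)"
    using assms by simp
  then show ?thesis
    using assms(1-3) by (simp add: M.smult_assoc1[symmetric] R.Units_closed)
qed

section \<open>The ring structure of a twisted group ring\<close>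

text \<open>
  The product sums over pairs from the exact supports, which change when elements are added.
  Enlarging the index sets to common finite sets makes the sum additive in each factor.
\<close>

lemma mult_coeff:
  assumes a: "a \<in> carrier A" and b: "b \<in> carrier A" and k: "k \<in> carrier G"
    and F: "finite F" "supp R G a \<subseteq> F" "F \<subseteq> carrier G"
    and H: "finite H" "supp R G b \<subseteq> H" "H \<subseteq> carrier G"
  shows "(a \<otimes>\<^bsub>A\<^esub> b) k =
    finsum R (\<lambda>(g, h). a g \<otimes>\<^bsub>R\<^esub> b h \<otimes>\<^bsub>R\<^esub> \<alpha> g h) {(g, h) \<in> F \<times> H. g \<otimes>\<^bsub>G\<^esub> h = k}"
proof -
  have "(a \<otimes>\<^bsub>A\<^esub> b) k = finsum R (\<lambda>(g, h). a g \<otimes>\<^bsub>R\<^esub> b h \<otimes>\<^bsub>R\<^esub> \<alpha> g h)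
      {(g, h) \<in> supp R G a \<times> supp R G b. g \<otimes>\<^bsub>G\<^esub> h = k}"
    using k by (simp add: A_mult)
  also have "\<dots> = finsum R (\<lambda>(g, h). a g \<otimes>\<^bsub>R\<^esub> b h \<otimes>\<^bsub>R\<^esub> \<alpha> g h) {(g, h) \<in> F \<times> H. g \<otimes>\<^bsub>G\<^esub> h = k}"
  proof (rule R.add.finprod_mono_neutral_cong_left)
    show "finite {(g, h) \<in> F \<times> H. g \<otimes>\<^bsub>G\<^esub> h = k}"
      by (rule finite_subset[of _ "F \<times> H"]) (use F H in auto)
    show "{(g, h) \<in> supp R G a \<times> supp R G b. g \<otimes>\<^bsub>G\<^esub> h = k} \<subseteq> {(g, h) \<in> F \<times> H. g \<otimes>\<^bsub>G\<^esub> h = k}"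
      using F H by auto
    show "(case p of (g, h) \<Rightarrow> a g \<otimes>\<^bsub>R\<^esub> b h \<otimes>\<^bsub>R\<^esub> \<alpha> g h) = \<zero>\<^bsub>R\<^esub>"
      if p: "p \<in> {(g, h) \<in> F \<times> H. g \<otimes>\<^bsub>G\<^esub> h = k} - {(g, h) \<in> supp R G a \<times> supp R G b. g \<otimes>\<^bsub>G\<^esub> h = k}"
      for p
    proof -
      obtain g h where gh: "p = (g, h)" "g \<in> carrier G" "h \<in> carrier G"
          "a g = \<zero>\<^bsub>R\<^esub> \<or> b h = \<zero>\<^bsub>R\<^esub>"
        using p F(3) H(3) by (fastforce simp: in_supp_iff)
      then show ?thesis using a b by auto
    qed
  qed (use a b subsetD[OF F(3)] subsetD[OF H(3)] in auto)
  finally show ?thesis .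
qed

lemma A_mult_closed:
  assumes a: "a \<in> carrier A" and b: "b \<in> carrier A"
  shows "a \<otimes>\<^bsub>A\<^esub> b \<in> carrier A"
proof -
  let ?P = "\<lambda>k. {(g, h) \<in> supp R G a \<times> supp R G b. g \<otimes>\<^bsub>G\<^esub> h = k}"
  have "(\<lambda>k\<in>carrier G. finsum R (\<lambda>(g, h). a g \<otimes>\<^bsub>R\<^esub> b h \<otimes>\<^bsub>R\<^esub> \<alpha> g h) (?P k)) \<in> carrier A"
  proof (rule A_memI[of "(\<lambda>(g, h). g \<otimes>\<^bsub>G\<^esub> h) ` (supp R G a \<times> supp R G b)"])
    show "finsum R (\<lambda>(g, h). a g \<otimes>\<^bsub>R\<^esub> b h \<otimes>\<^bsub>R\<^esub> \<alpha> g h) (?P k) \<in> carrier R" for k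
      using a b by (intro R.finsum_closed) (auto simp: in_supp_iff)
    show "finsum R (\<lambda>(g, h). a g \<otimes>\<^bsub>R\<^esub> b h \<otimes>\<^bsub>R\<^esub> \<alpha> g h) (?P k) = \<zero>\<^bsub>R\<^esub>"
      if "k \<notin> (\<lambda>(g, h). g \<otimes>\<^bsub>G\<^esub> h) ` (supp R G a \<times> supp R G b)" for k
    proof -
      have "?P k = {}" using that by force
      then show ?thesis by (simp only: R.finsum_empty)
    qed
  qed (use a b in simp)
  then show ?thesis by (simp add: A_mult)
qed

lemma A_l_distr:
  assumes a: "a \<in> carrier A" and b: "b \<in> carrier A" and c: "c \<in> carrier A"
  shows "(a \<oplus>\<^bsub>A\<^esub> b) \<otimes>\<^bsub>A\<^esub> c = a \<otimes>\<^bsub>A\<^esub> c \<oplus>\<^bsub>A\<^esub> b \<otimes>\<^bsub>A\<^esub> c"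
proof (rule A_eqI)
  fix k assume k: "k \<in> carrier G"
  let ?F = "supp R G a \<union> supp R G b" and ?H = "supp R G c"
  let ?P = "{(g, h) \<in> ?F \<times> ?H. g \<otimes>\<^bsub>G\<^esub> h = k}"
  have supp: "supp R G (a \<oplus>\<^bsub>A\<^esub> b) \<subseteq> ?F"
    using a b by (auto simp: in_supp_iff add_coeff)
  have "((a \<oplus>\<^bsub>A\<^esub> b) \<otimes>\<^bsub>A\<^esub> c) k = finsum R (\<lambda>(g, h). (a \<oplus>\<^bsub>A\<^esub> b) g \<otimes>\<^bsub>R\<^esub> c h \<otimes>\<^bsub>R\<^esub> \<alpha> g h) ?P"
    using a b c k supp by (intro mult_coeff) (simp_all add: A_add_closed supp_subset)
  also have "\<dots> = finsum R (\<lambda>p. (case p of (g, h) \<Rightarrow> a g \<otimes>\<^bsub>R\<^esub> c h \<otimes>\<^bsub>R\<^esub> \<alpha> g h) \<oplus>\<^bsub>R\<^esub>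
      (case p of (g, h) \<Rightarrow> b g \<otimes>\<^bsub>R\<^esub> c h \<otimes>\<^bsub>R\<^esub> \<alpha> g h)) ?P"
    using a b c by (intro R.finsum_cong') (auto simp: in_supp_iff add_coeff R.l_distr)
  also have "\<dots> = finsum R (\<lambda>(g, h). a g \<otimes>\<^bsub>R\<^esub> c h \<otimes>\<^bsub>R\<^esub> \<alpha> g h) ?P \<oplus>\<^bsub>R\<^esub>
      finsum R (\<lambda>(g, h). b g \<otimes>\<^bsub>R\<^esub> c h \<otimes>\<^bsub>R\<^esub> \<alpha> g h) ?P"
    using a b c by (intro R.finsum_addf) (auto simp: in_supp_iff)
  also have "finsum R (\<lambda>(g, h). a g \<otimes>\<^bsub>R\<^esub> c h \<otimes>\<^bsub>R\<^esub> \<alpha> g h) ?P = (a \<otimes>\<^bsub>A\<^esub> c) k"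
    using a b c k by (intro mult_coeff[symmetric]) (simp_all add: supp_subset)
  also have "finsum R (\<lambda>(g, h). b g \<otimes>\<^bsub>R\<^esub> c h \<otimes>\<^bsub>R\<^esub> \<alpha> g h) ?P = (b \<otimes>\<^bsub>A\<^esub> c) k"
    using a b c k by (intro mult_coeff[symmetric]) (simp_all add: supp_subset)
  finally show "((a \<oplus>\<^bsub>A\<^esub> b) \<otimes>\<^bsub>A\<^esub> c) k = (a \<otimes>\<^bsub>A\<^esub> c \<oplus>\<^bsub>A\<^esub> b \<otimes>\<^bsub>A\<^esub> c) k"
    using k by (simp add: add_coeff)
qed (use a b c in \<open>simp_all add: A_mult_closed A_add_closed\<close>)

lemma A_r_distr:
  assumes a: "a \<in> carrier A" and b: "b \<in> carrier A" and c: "c \<in> carrier A"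
  shows "c \<otimes>\<^bsub>A\<^esub> (a \<oplus>\<^bsub>A\<^esub> b) = c \<otimes>\<^bsub>A\<^esub> a \<oplus>\<^bsub>A\<^esub> c \<otimes>\<^bsub>A\<^esub> b"
proof (rule A_eqI)
  fix k assume k: "k \<in> carrier G"
  let ?F = "supp R G c" and ?H = "supp R G a \<union> supp R G b"
  let ?P = "{(g, h) \<in> ?F \<times> ?H. g \<otimes>\<^bsub>G\<^esub> h = k}"
  have supp: "supp R G (a \<oplus>\<^bsub>A\<^esub> b) \<subseteq> ?H"
    using a b by (auto simp: in_supp_iff add_coeff)
  have "(c \<otimes>\<^bsub>A\<^esub> (a \<oplus>\<^bsub>A\<^esub> b)) k = finsum R (\<lambda>(g, h). c g \<otimes>\<^bsub>R\<^esub> (a \<oplus>\<^bsub>A\<^esub> b) h \<otimes>\<^bsub>R\<^esub> \<alpha> g h) ?P"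
    using a b c k supp by (intro mult_coeff) (simp_all add: A_add_closed supp_subset)
  also have "\<dots> = finsum R (\<lambda>p. (case p of (g, h) \<Rightarrow> c g \<otimes>\<^bsub>R\<^esub> a h \<otimes>\<^bsub>R\<^esub> \<alpha> g h) \<oplus>\<^bsub>R\<^esub>
      (case p of (g, h) \<Rightarrow> c g \<otimes>\<^bsub>R\<^esub> b h \<otimes>\<^bsub>R\<^esub> \<alpha> g h)) ?P"
    using a b c by (intro R.finsum_cong') (auto simp: in_supp_iff add_coeff R.l_distr R.r_distr)
  also have "\<dots> = finsum R (\<lambda>(g, h). c g \<otimes>\<^bsub>R\<^esub> a h \<otimes>\<^bsub>R\<^esub> \<alpha> g h) ?P \<oplus>\<^bsub>R\<^esub>
      finsum R (\<lambda>(g, h). c g \<otimes>\<^bsub>R\<^esub> b h \<otimes>\<^bsub>R\<^esub> \<alpha> g h) ?P"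
    using a b c by (intro R.finsum_addf) (auto simp: in_supp_iff)
  also have "finsum R (\<lambda>(g, h). c g \<otimes>\<^bsub>R\<^esub> a h \<otimes>\<^bsub>R\<^esub> \<alpha> g h) ?P = (c \<otimes>\<^bsub>A\<^esub> a) k"
    using a b c k by (intro mult_coeff[symmetric]) (simp_all add: supp_subset)
  also have "finsum R (\<lambda>(g, h). c g \<otimes>\<^bsub>R\<^esub> b h \<otimes>\<^bsub>R\<^esub> \<alpha> g h) ?P = (c \<otimes>\<^bsub>A\<^esub> b) k"
    using a b c k by (intro mult_coeff[symmetric]) (simp_all add: supp_subset)
  finally show "(c \<otimes>\<^bsub>A\<^esub> (a \<oplus>\<^bsub>A\<^esub> b)) k = (c \<otimes>\<^bsub>A\<^esub> a \<oplus>\<^bsub>A\<^esub> c \<otimes>\<^bsub>A\<^esub> b) k"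
    using k by (simp add: add_coeff)
qed (use a b c in \<open>simp_all add: A_mult_closed A_add_closed\<close>)

lemma monomial_mult:
  assumes "r \<in> carrier R" "s \<in> carrier R" "g \<in> carrier G" "h \<in> carrier G"
  shows "(r \<odot>\<^bsub>A\<^esub> bar g) \<otimes>\<^bsub>A\<^esub> (s \<odot>\<^bsub>A\<^esub> bar h) = (r \<otimes>\<^bsub>R\<^esub> s \<otimes>\<^bsub>R\<^esub> \<alpha> g h) \<odot>\<^bsub>A\<^esub> bar (g \<otimes>\<^bsub>G\<^esub> h)"
proof (rule A_eqI)
  fix k assume k: "k \<in> carrier G"
  let ?a = "r \<odot>\<^bsub>A\<^esub> bar g" and ?b = "s \<odot>\<^bsub>A\<^esub> bar h"
  let ?P = "{(x, y) \<in> {g} \<times> {h}. x \<otimes>\<^bsub>G\<^esub> y = k}"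
  have "(?a \<otimes>\<^bsub>A\<^esub> ?b) k = finsum R (\<lambda>(x, y). ?a x \<otimes>\<^bsub>R\<^esub> ?b y \<otimes>\<^bsub>R\<^esub> \<alpha> x y) ?P"
    using assms k by (intro mult_coeff) (auto simp: in_supp_iff smult_coeff bar_coeff split: if_splits)
  also have "?P = (if g \<otimes>\<^bsub>G\<^esub> h = k then {(g, h)} else {})"
    by auto
  also have "finsum R (\<lambda>(x, y). ?a x \<otimes>\<^bsub>R\<^esub> ?b y \<otimes>\<^bsub>R\<^esub> \<alpha> x y) \<dots> =
      (if g \<otimes>\<^bsub>G\<^esub> h = k then r \<otimes>\<^bsub>R\<^esub> s \<otimes>\<^bsub>R\<^esub> \<alpha> g h else \<zero>\<^bsub>R\<^esub>)"
    using assms by (simp add: smult_coeff bar_coeff Pi_def)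
  also have "\<dots> = ((r \<otimes>\<^bsub>R\<^esub> s \<otimes>\<^bsub>R\<^esub> \<alpha> g h) \<odot>\<^bsub>A\<^esub> bar (g \<otimes>\<^bsub>G\<^esub> h)) k"
    using assms k by (simp add: smult_coeff bar_coeff)
  finally show "(?a \<otimes>\<^bsub>A\<^esub> ?b) k = ((r \<otimes>\<^bsub>R\<^esub> s \<otimes>\<^bsub>R\<^esub> \<alpha> g h) \<odot>\<^bsub>A\<^esub> bar (g \<otimes>\<^bsub>G\<^esub> h)) k" .
qed (use assms in \<open>simp_all add: A_mult_closed\<close>)

lemma A_zero_mult: "a \<in> carrier A \<Longrightarrow> \<zero>\<^bsub>A\<^esub> \<otimes>\<^bsub>A\<^esub> a = \<zero>\<^bsub>A\<^esub>"
  using A_l_distr[of "\<zero>\<^bsub>A\<^esub>" "\<zero>\<^bsub>A\<^esub>" a] by (metis A_mult_closed M.M.add.r_cancel_one' M.M.l_zero M.M.zero_closed)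

lemma A_mult_zero: "a \<in> carrier A \<Longrightarrow> a \<otimes>\<^bsub>A\<^esub> \<zero>\<^bsub>A\<^esub> = \<zero>\<^bsub>A\<^esub>"
  using A_r_distr[of "\<zero>\<^bsub>A\<^esub>" "\<zero>\<^bsub>A\<^esub>" a] by (metis A_mult_closed M.M.add.r_cancel_one' M.M.l_zero M.M.zero_closed)

lemma smult_mult:
  assumes r: "r \<in> carrier R" and a: "a \<in> carrier A" and b: "b \<in> carrier A"
  shows "(r \<odot>\<^bsub>A\<^esub> a) \<otimes>\<^bsub>A\<^esub> b = r \<odot>\<^bsub>A\<^esub> (a \<otimes>\<^bsub>A\<^esub> b) \<and> a \<otimes>\<^bsub>A\<^esub> (r \<odot>\<^bsub>A\<^esub> b) = r \<odot>\<^bsub>A\<^esub> (a \<otimes>\<^bsub>A\<^esub> b)"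
  using a
proof (induction a rule: A_induct)
  case zero
  then show ?case using r b by (simp add: A_zero_mult)
next
  case (monomial s g)
  show ?case using b
  proof (induction b rule: A_induct)
    case zero
    then show ?case using r monomial by (simp add: A_mult_zero)
  next
    case (monomial t h)
    then show ?case using r \<open>s \<in> carrier R\<close> \<open>g \<in> carrier G\<close>
      by (simp add: monomial_mult M.smult_assoc1[symmetric] R.m_ac)
  next
    case (add b c)
    then show ?case using r monomial
      by (simp add: A_r_distr M.smult_r_distr A_mult_closed)
  qed
next
  case (add a c)
  then show ?case using r b
    by (simp add: A_l_distr M.smult_r_distr A_mult_closed)
qed

lemmas smult_mult_left = smult_mult[THEN conjunct1]
lemmas smult_mult_right = smult_mult[THEN conjunct2]

lemma bar_mult:
  assumes "g \<in> carrier G" "h \<in> carrier G"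
  shows "bar g \<otimes>\<^bsub>A\<^esub> bar h = \<alpha> g h \<odot>\<^bsub>A\<^esub> bar (g \<otimes>\<^bsub>G\<^esub> h)"
  using monomial_mult[of "\<one>\<^bsub>R\<^esub>" "\<one>\<^bsub>R\<^esub>" g h] assms by simp

text \<open>
  Associativity on basis elements is the cocycle identity.
\<close>

lemma bar_mult_assoc:
  assumes "g \<in> carrier G" "h \<in> carrier G" "k \<in> carrier G"
  shows "(bar g \<otimes>\<^bsub>A\<^esub> bar h) \<otimes>\<^bsub>A\<^esub> bar k = bar g \<otimes>\<^bsub>A\<^esub> (bar h \<otimes>\<^bsub>A\<^esub> bar k)"
  using assms alpha_cocycle[of g h k]
  by (simp add: bar_mult smult_mult_left smult_mult_right M.smult_assoc1[symmetric] G.m_assoc)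

lemma A_mult_assoc:
  assumes a: "a \<in> carrier A" and b: "b \<in> carrier A" and c: "c \<in> carrier A"
  shows "(a \<otimes>\<^bsub>A\<^esub> b) \<otimes>\<^bsub>A\<^esub> c = a \<otimes>\<^bsub>A\<^esub> (b \<otimes>\<^bsub>A\<^esub> c)"
  using a
proof (induction a rule: A_induct)
  case zero
  then show ?case using b c by (simp add: A_zero_mult A_mult_closed)
next
  case (monomial r g)
  have "(bar g \<otimes>\<^bsub>A\<^esub> b) \<otimes>\<^bsub>A\<^esub> c = bar g \<otimes>\<^bsub>A\<^esub> (b \<otimes>\<^bsub>A\<^esub> c)"
    using b
  proof (induction b rule: A_induct)
    case zero
    then show ?case using c by (simp add: A_zero_mult A_mult_zero A_mult_closed)
  next
    case (monomial s h)
    have "(bar g \<otimes>\<^bsub>A\<^esub> bar h) \<otimes>\<^bsub>A\<^esub> c = bar g \<otimes>\<^bsub>A\<^esub> (bar h \<otimes>\<^bsub>A\<^esub> c)"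
      using c
    proof (induction c rule: A_induct)
      case zero
      then show ?case by (simp add: A_mult_zero A_mult_closed)
    next
      case (monomial t k)
      then show ?case using \<open>g \<in> carrier G\<close> \<open>h \<in> carrier G\<close>
        by (simp add: smult_mult_right A_mult_closed bar_mult_assoc)
    next
      case (add c d)
      then show ?case by (simp add: A_r_distr A_mult_closed)
    qed
    then show ?case using monomial c
      by (simp add: smult_mult_right smult_mult_left A_mult_closed)
  next
    case (add b d)
    then show ?case using c by (simp add: A_l_distr A_r_distr A_mult_closed)
  qed
  then show ?case using monomial b c
    by (simp add: smult_mult_left A_mult_closed)
next
  case (add a d)
  then show ?case using b c by (simp add: A_l_distr A_mult_closed)
qed

lemma bar_one_mult:
  assumes "a \<in> carrier A"
  shows "bar \<one>\<^bsub>G\<^esub> \<otimes>\<^bsub>A\<^esub> a = a" "a \<otimes>\<^bsub>A\<^esub> bar \<one>\<^bsub>G\<^esub> = a"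
  using assms
proof (induction a rule: A_induct)
  case zero
  {
    case 1 show ?case by (simp add: A_mult_zero)
  next
    case 2 show ?case by (simp add: A_zero_mult)
  }
next
  case (monomial r g)
  {
    case 1 show ?case using monomial by (simp add: smult_mult_right bar_mult)
  next
    case 2 show ?case using monomial by (simp add: smult_mult_left bar_mult)
  }
next
  case (add a b)
  {
    case 1 show ?case using add by (simp add: A_r_distr)
  next
    case 2 show ?case using add by (simp add: A_l_distr)
  }
qed

sublocale A: ring A
proof (rule ringI)
  show "Group.monoid A"
    by (rule monoidI) (simp_all add: A_mult_closed A_mult_assoc A_one bar_one_mult)
qed (simp_all add: abelian_group_A A_l_distr A_r_distr)

end

section \<open>Linear extensions and derivations\<close>

context twisted
begin

definition lin_ext :: "('g \<Rightarrow> 'g \<Rightarrow> 'r) \<Rightarrow> ('g \<Rightarrow> 'r) \<Rightarrow> 'g \<Rightarrow> 'r" where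
  "lin_ext D a = (\<Oplus>\<^bsub>A\<^esub>g\<in>supp R G a. a g \<odot>\<^bsub>A\<^esub> D g)"

text \<open>
  As for products, sums over the exact supports of different elements are compared on a common
  finite index set.
\<close>

lemma lin_ext_superset:
  assumes D: "D \<in> carrier G \<rightarrow> carrier A" and a: "a \<in> carrier A"
    and F: "finite F" "supp R G a \<subseteq> F" "F \<subseteq> carrier G"
  shows "lin_ext D a = (\<Oplus>\<^bsub>A\<^esub>g\<in>F. a g \<odot>\<^bsub>A\<^esub> D g)"
  unfolding lin_ext_def
proof (rule M.M.add.finprod_mono_neutral_cong_left)
  show "a g \<odot>\<^bsub>A\<^esub> D g = \<zero>\<^bsub>A\<^esub>" if "g \<in> F - supp R G a" for g
  proof -
    have "g \<in> carrier G" "a g = \<zero>\<^bsub>R\<^esub>"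
      using that F by (auto simp: in_supp_iff)
    then show ?thesis using D by (simp add: Pi_iff)
  qed
  show "(\<lambda>g. a g \<odot>\<^bsub>A\<^esub> D g) \<in> F \<rightarrow> carrier A"
    using D a F by (auto simp: Pi_iff)
qed (use F in auto)

lemma lin_ext_closed:
  assumes "D \<in> carrier G \<rightarrow> carrier A" "a \<in> carrier A"
  shows "lin_ext D a \<in> carrier A"
  unfolding lin_ext_def using assms by (auto simp: Pi_iff in_supp_iff intro!: M.M.finsum_closed)

lemma lin_ext_zero: "lin_ext D \<zero>\<^bsub>A\<^esub> = \<zero>\<^bsub>A\<^esub>"
proof -
  have "supp R G \<zero>\<^bsub>A\<^esub> = {}" by (auto simp: in_supp_iff zero_coeff)
  then show ?thesis by (simp add: lin_ext_def)
qed

lemma lin_ext_add: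
  assumes D: "D \<in> carrier G \<rightarrow> carrier A" and a: "a \<in> carrier A" and b: "b \<in> carrier A"
  shows "lin_ext D (a \<oplus>\<^bsub>A\<^esub> b) = lin_ext D a \<oplus>\<^bsub>A\<^esub> lin_ext D b"
proof -
  let ?F = "supp R G a \<union> supp R G b"
  have F: "finite ?F" "?F \<subseteq> carrier G"
    using a b supp_subset by auto
  have "supp R G (a \<oplus>\<^bsub>A\<^esub> b) \<subseteq> ?F"
    using a b by (auto simp: in_supp_iff add_coeff)
  then have "lin_ext D (a \<oplus>\<^bsub>A\<^esub> b) = (\<Oplus>\<^bsub>A\<^esub>g\<in>?F. (a \<oplus>\<^bsub>A\<^esub> b) g \<odot>\<^bsub>A\<^esub> D g)"
    using D a b F by (intro lin_ext_superset) simp_all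
  also have "\<dots> = (\<Oplus>\<^bsub>A\<^esub>g\<in>?F. a g \<odot>\<^bsub>A\<^esub> D g \<oplus>\<^bsub>A\<^esub> b g \<odot>\<^bsub>A\<^esub> D g)"
    using D a b by (intro M.M.finsum_cong')
      (auto simp: Pi_iff in_supp_iff add_coeff M.smult_l_distr)
  also have "\<dots> = (\<Oplus>\<^bsub>A\<^esub>g\<in>?F. a g \<odot>\<^bsub>A\<^esub> D g) \<oplus>\<^bsub>A\<^esub> (\<Oplus>\<^bsub>A\<^esub>g\<in>?F. b g \<odot>\<^bsub>A\<^esub> D g)"
    using D a b by (intro M.M.finsum_addf) (auto simp: Pi_iff in_supp_iff)
  also have "(\<Oplus>\<^bsub>A\<^esub>g\<in>?F. a g \<odot>\<^bsub>A\<^esub> D g) = lin_ext D a"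
    using D a F by (intro lin_ext_superset[symmetric]) simp_all
  also have "(\<Oplus>\<^bsub>A\<^esub>g\<in>?F. b g \<odot>\<^bsub>A\<^esub> D g) = lin_ext D b"
    using D b F by (intro lin_ext_superset[symmetric]) simp_all
  finally show ?thesis .
qed

lemma lin_ext_monomial:
  assumes D: "D \<in> carrier G \<rightarrow> carrier A" and r: "r \<in> carrier R" and g: "g \<in> carrier G"
  shows "lin_ext D (r \<odot>\<^bsub>A\<^esub> bar g) = r \<odot>\<^bsub>A\<^esub> D g"
proof -
  have "supp R G (r \<odot>\<^bsub>A\<^esub> bar g) \<subseteq> {g}"
    using r g by (auto simp: in_supp_iff smult_coeff bar_coeff split: if_splits)
  then have "lin_ext D (r \<odot>\<^bsub>A\<^esub> bar g) = (\<Oplus>\<^bsub>A\<^esub>h\<in>{g}. (r \<odot>\<^bsub>A\<^esub> bar g) h \<odot>\<^bsub>A\<^esub> D h)"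
    using D r g by (intro lin_ext_superset) simp_all
  then show ?thesis
    using D r g by (simp add: Pi_iff smult_coeff bar_coeff)
qed

lemma R_derivation_iff:
  "R_derivation R G \<alpha> d \<longleftrightarrow>
    d \<in> carrier A \<rightarrow> carrier A \<and>
    (\<forall>a\<in>carrier A. \<forall>b\<in>carrier A. d (a \<oplus>\<^bsub>A\<^esub> b) = d a \<oplus>\<^bsub>A\<^esub> d b) \<and>
    (\<forall>a\<in>carrier A. \<forall>b\<in>carrier A. d (a \<otimes>\<^bsub>A\<^esub> b) = d a \<otimes>\<^bsub>A\<^esub> b \<oplus>\<^bsub>A\<^esub> a \<otimes>\<^bsub>A\<^esub> d b) \<and>
    (\<forall>r\<in>carrier R. d (r \<odot>\<^bsub>A\<^esub> bar \<one>\<^bsub>G\<^esub>) = \<zero>\<^bsub>A\<^esub>)"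
  by (simp add: R_derivation_def derivation_def Let_def)

text \<open>
  Since \<open>r \<odot> a = (r \<odot> bar 1) a\<close> and \<open>d\<close> kills \<open>r \<odot> bar 1\<close>, the Leibniz rule gives linearity over
  \<open>R\<close>. This is why an \<open>R\<close>-derivation is determined by its values on the basis.
\<close>

lemma R_derivation_smult:
  assumes d: "R_derivation R G \<alpha> d" and r: "r \<in> carrier R" and a: "a \<in> carrier A"
  shows "d (r \<odot>\<^bsub>A\<^esub> a) = r \<odot>\<^bsub>A\<^esub> d a"
proof -
  have da: "d a \<in> carrier A" using d a by (auto simp: R_derivation_iff)
  have "d (r \<odot>\<^bsub>A\<^esub> a) = d ((r \<odot>\<^bsub>A\<^esub> bar \<one>\<^bsub>G\<^esub>) \<otimes>\<^bsub>A\<^esub> a)"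
    using r a by (simp add: smult_mult_left bar_one_mult)
  also have "\<dots> = d (r \<odot>\<^bsub>A\<^esub> bar \<one>\<^bsub>G\<^esub>) \<otimes>\<^bsub>A\<^esub> a \<oplus>\<^bsub>A\<^esub> (r \<odot>\<^bsub>A\<^esub> bar \<one>\<^bsub>G\<^esub>) \<otimes>\<^bsub>A\<^esub> d a"
    using d r a by (simp add: R_derivation_iff)
  also have "\<dots> = r \<odot>\<^bsub>A\<^esub> d a"
    using d r a da by (simp add: R_derivation_iff smult_mult_left bar_one_mult)
  finally show ?thesis .
qed

lemma R_derivation_eq_lin_ext:
  assumes d: "R_derivation R G \<alpha> d" and a: "a \<in> carrier A"
  shows "d a = lin_ext (\<lambda>g. d (bar g)) a"
  using a
proof (induction a rule: A_induct)
  have D: "(\<lambda>g. d (bar g)) \<in> carrier G \<rightarrow> carrier A"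
    using d by (auto simp: R_derivation_iff)
  {
    case zero
    have "d (\<zero>\<^bsub>R\<^esub> \<odot>\<^bsub>A\<^esub> bar \<one>\<^bsub>G\<^esub>) = \<zero>\<^bsub>A\<^esub>" using d by (simp add: R_derivation_iff del: M.smult_l_null)
    then show ?case by (simp add: lin_ext_zero)
  next
    case (monomial r g)
    then show ?case using d D by (simp add: lin_ext_monomial R_derivation_smult)
  next
    case (add a b)
    then show ?case using d D by (simp add: lin_ext_add R_derivation_iff)
  }
qed

text \<open>
  Both sides of the Leibniz rule are biadditive, so it suffices to have it for pairs of basis
  elements, where the product picks up the factor \<open>\<alpha> g h\<close>.
\<close>

lemma lin_ext_R_derivation:
  assumes D: "D \<in> carrier G \<rightarrow> carrier A"
    and Leibniz: "\<And>g h. g \<in> carrier G \<Longrightarrow> h \<in> carrier G \<Longrightarrow>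
      \<alpha> g h \<odot>\<^bsub>A\<^esub> D (g \<otimes>\<^bsub>G\<^esub> h) = D g \<otimes>\<^bsub>A\<^esub> bar h \<oplus>\<^bsub>A\<^esub> bar g \<otimes>\<^bsub>A\<^esub> D h"
  shows "R_derivation R G \<alpha> (lin_ext D)"
proof -
  have D_closed [simp]: "D g \<in> carrier A" if "g \<in> carrier G" for g
    using D that by auto
  note [simp] = lin_ext_closed[OF D] lin_ext_zero lin_ext_add[OF D] lin_ext_monomial[OF D]
  \<comment> \<open>Normalization of the cocycle forces \<open>D 1 = 0\<close>, hence \<open>d(R) = 0\<close>.\<close>
  have "D \<one>\<^bsub>G\<^esub> = D \<one>\<^bsub>G\<^esub> \<oplus>\<^bsub>A\<^esub> D \<one>\<^bsub>G\<^esub>"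
    using Leibniz[of "\<one>\<^bsub>G\<^esub>" "\<one>\<^bsub>G\<^esub>"] by (simp add: bar_one_mult)
  then have D_one: "D \<one>\<^bsub>G\<^esub> = \<zero>\<^bsub>A\<^esub>"
    by (metis D_closed G.one_closed M.M.add.r_cancel_one')
  have "lin_ext D (a \<otimes>\<^bsub>A\<^esub> b) = lin_ext D a \<otimes>\<^bsub>A\<^esub> b \<oplus>\<^bsub>A\<^esub> a \<otimes>\<^bsub>A\<^esub> lin_ext D b"
    if a: "a \<in> carrier A" and b: "b \<in> carrier A" for a b
    using a
  proof (induction a rule: A_induct)
    case zero
    then show ?case using b by simp
  next
    case (monomial r g)
    note rg = monomial
    show ?case using b
    proof (induction b rule: A_induct)
      case zero
      then show ?case using rg by simp
    next
      case (monomial s h)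
      have "lin_ext D ((r \<odot>\<^bsub>A\<^esub> bar g) \<otimes>\<^bsub>A\<^esub> (s \<odot>\<^bsub>A\<^esub> bar h)) = (r \<otimes>\<^bsub>R\<^esub> s) \<odot>\<^bsub>A\<^esub> (\<alpha> g h \<odot>\<^bsub>A\<^esub> D (g \<otimes>\<^bsub>G\<^esub> h))"
        using rg monomial by (simp add: monomial_mult M.smult_assoc1[symmetric])
      also have "\<dots> = (r \<otimes>\<^bsub>R\<^esub> s) \<odot>\<^bsub>A\<^esub> (D g \<otimes>\<^bsub>A\<^esub> bar h \<oplus>\<^bsub>A\<^esub> bar g \<otimes>\<^bsub>A\<^esub> D h)"
        using rg monomial by (simp only: Leibniz)
      also have "\<dots> = lin_ext D (r \<odot>\<^bsub>A\<^esub> bar g) \<otimes>\<^bsub>A\<^esub> (s \<odot>\<^bsub>A\<^esub> bar h) \<oplus>\<^bsub>A\<^esub>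
          (r \<odot>\<^bsub>A\<^esub> bar g) \<otimes>\<^bsub>A\<^esub> lin_ext D (s \<odot>\<^bsub>A\<^esub> bar h)"
        using rg monomial
        by (simp add: smult_mult_left smult_mult_right M.smult_r_distr M.smult_assoc1[symmetric]
              R.m_comm)
      finally show ?case .
    next
      case (add b c)
      then show ?case using rg by (simp add: A.r_distr M.M.a_ac)
    qed
  next
    case (add a c)
    then show ?case using b by (simp add: A.l_distr M.M.a_ac)
  qed
  then show ?thesis
    using D_one by (simp add: R_derivation_iff Pi_iff)
qed

end

section \<open>The recursion for the Fox derivative of a word\<close>

lemma (in comm_monoid) finprod_lessThan_Suc_shift:
  assumes "f \<in> {..<Suc n} \<rightarrow> carrier G"
  shows "finprod G f {..<Suc n} = f 0 \<otimes> finprod G (\<lambda>i. f (Suc i)) {..<n}"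
proof -
  have "finprod G f {..<Suc n} = finprod G f (insert 0 (Suc ` {..<n}))"
    by (simp add: lessThan_Suc_eq_insert_0)
  also have "\<dots> = f 0 \<otimes> finprod G f (Suc ` {..<n})"
    using assms by (intro finprod_insert) (auto simp: Pi_iff)
  also have "finprod G f (Suc ` {..<n}) = finprod G (\<lambda>i. f (Suc i)) {..<n}"
    using assms by (intro finprod_reindex) (auto simp: Pi_iff)
  finally show ?thesis .
qed

text \<open>
  Here \<open>S\<close> is only an alphabet with values in \<open>G\<close>: the Leibniz rule and the invariance
  under free cancellation are facts about words. The relators enter in \<open>fs_kernel\<close>.
\<close>

locale twisted_words = twisted R G \<alpha>
  for R :: "('r, 'n) ring_scheme" and G :: "('g, 'm) monoid_scheme" and \<alpha> +
  fixes \<iota> :: "'s \<Rightarrow> 'g" and S :: "'s set" and f :: "'s \<Rightarrow> 'g \<Rightarrow> 'r"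
  assumes generator_closed: "s \<in> S \<Longrightarrow> \<iota> s \<in> carrier G"
    and f_closed: "s \<in> S \<Longrightarrow> f s \<in> carrier A"
begin

abbreviation lval where "lval \<equiv> letter_val G \<iota>"
abbreviation wval where "wval \<equiv> word_val G \<iota>"
abbreviation fl where "fl \<equiv> fstar_letter R G \<alpha> \<iota> f"
abbreviation fs where "fs \<equiv> fstar R G \<alpha> \<iota> f"

lemma lval_closed [simp]: "x \<in> letters S \<Longrightarrow> lval x \<in> carrier G"
  using generator_closed by auto

lemma wval_closed [simp]: "w \<in> words S \<Longrightarrow> wval w \<in> carrier G"
  by (induction w) (simp_all del: Un_iff)

lemma lval_letter_inv: "x \<in> letters S \<Longrightarrow> lval (letter_inv x) = inv\<^bsub>G\<^esub> lval x"
  using generator_closed by (cases x) auto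

lemma wval_append [simp]:
  "u \<in> words S \<Longrightarrow> v \<in> words S \<Longrightarrow> wval (u @ v) = wval u \<otimes>\<^bsub>G\<^esub> wval v"
  by (induction u) (simp_all add: G.m_assoc del: Un_iff)

lemma fl_closed [simp]: "x \<in> letters S \<Longrightarrow> fl x \<in> carrier A"
  using generator_closed f_closed by (auto simp: Let_def)

lemma words_nth: "w \<in> words S \<Longrightarrow> i < length w \<Longrightarrow> w ! i \<in> letters S"
  unfolding words_def by (metis in_listsD nth_mem)

lemma words_drop: "w \<in> words S \<Longrightarrow> drop i w \<in> words S"
  unfolding words_def by (meson in_lists_conv_set in_set_dropD)

text \<open>
  By \<open>bar_prod_eq\<close> below, the product of the basis elements of the letters of \<open>w\<close> is
  \<open>\<beta>\<^sub>w\<close> times the basis element of the value of \<open>w\<close>; bracketing to the right explains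
  the form of \<open>\<beta>\<^sub>w\<close>. For \<open>w = []\<close> the extra factor is \<open>\<alpha> x 1 = 1\<close>.
\<close>

lemma beta_Cons:
  assumes "x # w \<in> words S"
  shows "beta R G \<alpha> \<iota> (x # w) = \<alpha> (lval x) (wval w) \<otimes>\<^bsub>R\<^esub> beta R G \<alpha> \<iota> w"
proof (cases w)
  case Nil
  then show ?thesis using assms by (simp add: beta_def del: Un_iff)
next
  case (Cons y v)
  let ?g = "\<lambda>w i. \<alpha> (lval (w ! i)) (wval (drop (Suc i) w))"
  have g: "?g w i \<in> carrier R" if "w \<in> words S" "i < length w" for w i
    using that words_nth words_drop by (simp del: Un_iff)
  have len: "length w = Suc (length w - 1)" using Cons by simp
  have "beta R G \<alpha> \<iota> (x # w) = finprod R (?g (x # w)) {..<Suc (length w - 1)}"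
    using len by (simp add: beta_def)
  also have "\<dots> = ?g (x # w) 0 \<otimes>\<^bsub>R\<^esub> finprod R (\<lambda>i. ?g (x # w) (Suc i)) {..<length w - 1}"
    using g[OF assms] len by (intro R.finprod_lessThan_Suc_shift) auto
  finally show ?thesis by (simp add: beta_def)
qed

lemma beta_Units [simp]: "w \<in> words S \<Longrightarrow> beta R G \<alpha> \<iota> w \<in> Units R"
proof (induction w)
  case Nil
  show ?case by (simp add: beta_def)
next
  case (Cons x w)
  then show ?case by (simp add: beta_Cons del: Un_iff)
qed

lemma bar_prod_Nil [simp]: "bar_prod R G \<alpha> \<iota> [] = bar \<one>\<^bsub>G\<^esub>"
  and bar_prod_Cons [simp]: "bar_prod R G \<alpha> \<iota> (x # w) = bar (lval x) \<otimes>\<^bsub>A\<^esub> bar_prod R G \<alpha> \<iota> w"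
  by (simp_all add: bar_prod_def A_one Let_def)

lemma bar_prod_closed [simp]: "bar_prod R G \<alpha> \<iota> w \<in> carrier A"
  by (induction w) simp_all

lemma bar_prod_eq: "w \<in> words S \<Longrightarrow> bar_prod R G \<alpha> \<iota> w = beta R G \<alpha> \<iota> w \<odot>\<^bsub>A\<^esub> bar (wval w)"
proof (induction w)
  case Nil
  show ?case by (simp add: beta_def)
next
  case (Cons x w)
  then show ?case
    by (simp add: beta_Cons R.Units_closed smult_mult_right bar_mult M.smult_assoc1[symmetric]
        R.m_comm del: Un_iff)
qed

text \<open>
  The numerator of \<open>f\<^sup>*(w)\<close>.
\<close>

definition word_sum :: "'s letter list \<Rightarrow> 'g \<Rightarrow> 'r" where
  "word_sum w = (\<Oplus>\<^bsub>A\<^esub>i\<in>{..<length w}.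
     bar_prod R G \<alpha> \<iota> (take i w) \<otimes>\<^bsub>A\<^esub> fl (w ! i) \<otimes>\<^bsub>A\<^esub> bar_prod R G \<alpha> \<iota> (drop (Suc i) w))"

lemma word_sum_closed [simp]: "w \<in> words S \<Longrightarrow> word_sum w \<in> carrier A"
  unfolding word_sum_def by (rule M.M.finsum_closed) (auto simp: words_nth simp del: Un_iff)

lemma word_sum_Cons:
  assumes "x # w \<in> words S"
  shows "word_sum (x # w) = fl x \<otimes>\<^bsub>A\<^esub> bar_prod R G \<alpha> \<iota> w \<oplus>\<^bsub>A\<^esub> bar (lval x) \<otimes>\<^bsub>A\<^esub> word_sum w"
proof -
  let ?h = "\<lambda>w i. bar_prod R G \<alpha> \<iota> (take i w) \<otimes>\<^bsub>A\<^esub> fl (w ! i) \<otimes>\<^bsub>A\<^esub> bar_prod R G \<alpha> \<iota> (drop (Suc i) w)"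
  have h: "?h w i \<in> carrier A" if "w \<in> words S" "i < length w" for w i
    using that words_nth by (simp del: Un_iff)
  have x: "x \<in> letters S" and w: "w \<in> words S"
    using assms by simp_all
  have "word_sum (x # w) = ?h (x # w) 0 \<oplus>\<^bsub>A\<^esub> (\<Oplus>\<^bsub>A\<^esub>i\<in>{..<length w}. ?h (x # w) (Suc i))"
    using h[OF assms] M.M.add.finprod_lessThan_Suc_shift[of "?h (x # w)" "length w"]
    by (auto simp: word_sum_def)
  also have "(\<Oplus>\<^bsub>A\<^esub>i\<in>{..<length w}. ?h (x # w) (Suc i)) =
      (\<Oplus>\<^bsub>A\<^esub>i\<in>{..<length w}. bar (lval x) \<otimes>\<^bsub>A\<^esub> ?h w i)"
    using h[OF w] words_nth[OF w]
    by (intro M.M.finsum_cong') (auto simp: A.m_assoc simp del: Un_iff)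
  also have "\<dots> = bar (lval x) \<otimes>\<^bsub>A\<^esub> word_sum w"
    unfolding word_sum_def using h[OF w] by (intro A.finsum_rdistr[symmetric]) auto
  finally show ?thesis
    using x by (simp add: bar_one_mult del: Un_iff)
qed

text \<open>
  The clause for words with at least two letters also covers the empty word and single letters,
  so that \<open>f\<^sup>*\<close> can be treated without case distinctions.
\<close>

lemma fs_eq_word_sum:
  assumes "w \<in> words S"
  shows "fs w = inv\<^bsub>R\<^esub> beta R G \<alpha> \<iota> w \<odot>\<^bsub>A\<^esub> word_sum w"
proof (cases w rule: remdups_adj.cases)
  case 1
  then show ?thesis by (simp add: fstar_def word_sum_def beta_def Let_def)
next
  case (2 x)
  then show ?thesis using assms
    by (simp add: fstar_def word_sum_def Let_def beta_def bar_one_mult lessThan_Suc Pi_iff del: Un_iff)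
next
  case (3 x y v)
  then show ?thesis by (simp add: fstar_def word_sum_def Let_def)
qed

lemma fs_closed [simp]: "w \<in> words S \<Longrightarrow> fs w \<in> carrier A"
  by (simp add: fs_eq_word_sum)

lemma fs_Nil [simp]: "fs [] = \<zero>\<^bsub>A\<^esub>"
  by (simp add: fstar_def Let_def)

text \<open>
  Dividing the recursions for the numerator and for \<open>\<beta>\<close> gives the Leibniz rule for
  prepending a letter; \<open>\<alpha>\<close> appears because \<open>bar (lval x)\<close> times \<open>bar (wval w)\<close> is
  \<open>\<alpha> (lval x) (wval w)\<close> times the basis element of the product.
\<close>

lemma fs_Cons:
  assumes "x # w \<in> words S"
  shows "\<alpha> (lval x) (wval w) \<odot>\<^bsub>A\<^esub> fs (x # w) = fl x \<otimes>\<^bsub>A\<^esub> bar (wval w) \<oplus>\<^bsub>A\<^esub> bar (lval x) \<otimes>\<^bsub>A\<^esub> fs w"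
proof -
  let ?a = "\<alpha> (lval x) (wval w)" and ?b = "beta R G \<alpha> \<iota> w"
  have x: "x \<in> letters S" and w: "w \<in> words S"
    using assms by simp_all
  have a: "?a \<in> Units R" and b: "?b \<in> Units R"
    using x w by (simp_all del: Un_iff)
  have "?b \<odot>\<^bsub>A\<^esub> (?a \<odot>\<^bsub>A\<^esub> fs (x # w)) = word_sum (x # w)"
    using a b assms R.Units_m_closed[OF a b] word_sum_closed[OF assms]
    by (simp add: fs_eq_word_sum[OF assms] beta_Cons[OF assms] M.smult_assoc1[symmetric]
        R.Units_closed R.m_comm[of ?b ?a] R.m_assoc[symmetric] del: Un_iff words_simps)
  also have "\<dots> = fl x \<otimes>\<^bsub>A\<^esub> (?b \<odot>\<^bsub>A\<^esub> bar (wval w)) \<oplus>\<^bsub>A\<^esub> bar (lval x) \<otimes>\<^bsub>A\<^esub> (?b \<odot>\<^bsub>A\<^esub> fs w)"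
    using w b by (simp add: word_sum_Cons[OF assms] bar_prod_eq fs_eq_word_sum
        M.smult_assoc1[symmetric] R.Units_closed)
  also have "\<dots> = ?b \<odot>\<^bsub>A\<^esub> (fl x \<otimes>\<^bsub>A\<^esub> bar (wval w) \<oplus>\<^bsub>A\<^esub> bar (lval x) \<otimes>\<^bsub>A\<^esub> fs w)"
    using x w b by (simp add: smult_mult_right M.smult_r_distr R.Units_closed del: Un_iff)
  finally show ?thesis
    by (rule smult_cancel[OF b, rotated 2])
      (use x w fs_closed[OF assms] in \<open>simp_all del: Un_iff\<close>)
qed

text \<open>
  The Leibniz rule for words, the heart of the proof. In the induction the factor
  \<open>\<alpha> g h\<close> is cleared, and the four values of \<open>\<alpha>\<close> that occur are related by the cocycle identity
  for \<open>(g, h, k)\<close>.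
\<close>

lemma fs_append:
  assumes "u \<in> words S" "v \<in> words S"
  shows "\<alpha> (wval u) (wval v) \<odot>\<^bsub>A\<^esub> fs (u @ v) = fs u \<otimes>\<^bsub>A\<^esub> bar (wval v) \<oplus>\<^bsub>A\<^esub> bar (wval u) \<otimes>\<^bsub>A\<^esub> fs v"
  using assms(1)
proof (induction u)
  case Nil
  then show ?case using assms(2) by (simp add: bar_one_mult)
next
  case (Cons x u)
  then have x: "x \<in> letters S" and u: "u \<in> words S" by simp_all
  note v = assms(2)
  define g h k where "g = lval x" and "h = wval u" and "k = wval v"
  have [simp]: "g \<in> carrier G" "h \<in> carrier G" "k \<in> carrier G"
    using x u v by (simp_all add: g_def h_def k_def del: Un_iff)
  have closed [simp]: "fs u \<in> carrier A" "fs v \<in> carrier A" "fs (u @ v) \<in> carrier A"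
    "fs (x # u) \<in> carrier A" "fs (x # u @ v) \<in> carrier A" "fl x \<in> carrier A"
    using x u v by (simp_all del: Un_iff)
  have IH: "fs u \<otimes>\<^bsub>A\<^esub> bar k \<oplus>\<^bsub>A\<^esub> bar h \<otimes>\<^bsub>A\<^esub> fs v = \<alpha> h k \<odot>\<^bsub>A\<^esub> fs (u @ v)"
    using Cons.IH[OF u] by (simp add: h_def k_def)
  have "\<alpha> g h \<odot>\<^bsub>A\<^esub> (fs (x # u) \<otimes>\<^bsub>A\<^esub> bar k \<oplus>\<^bsub>A\<^esub> bar (g \<otimes>\<^bsub>G\<^esub> h) \<otimes>\<^bsub>A\<^esub> fs v) =
      (fl x \<otimes>\<^bsub>A\<^esub> bar h \<oplus>\<^bsub>A\<^esub> bar g \<otimes>\<^bsub>A\<^esub> fs u) \<otimes>\<^bsub>A\<^esub> bar k \<oplus>\<^bsub>A\<^esub> (bar g \<otimes>\<^bsub>A\<^esub> bar h) \<otimes>\<^bsub>A\<^esub> fs v"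
    using fs_Cons[of x u] x u
    by (simp add: M.smult_r_distr smult_mult_left[symmetric] bar_mult g_def h_def del: Un_iff)
  also have "\<dots> = fl x \<otimes>\<^bsub>A\<^esub> (bar h \<otimes>\<^bsub>A\<^esub> bar k) \<oplus>\<^bsub>A\<^esub> bar g \<otimes>\<^bsub>A\<^esub> (fs u \<otimes>\<^bsub>A\<^esub> bar k \<oplus>\<^bsub>A\<^esub> bar h \<otimes>\<^bsub>A\<^esub> fs v)"
    by (simp add: A.l_distr A.r_distr A.m_assoc M.M.a_assoc)
  also have "\<dots> = \<alpha> h k \<odot>\<^bsub>A\<^esub> (fl x \<otimes>\<^bsub>A\<^esub> bar (h \<otimes>\<^bsub>G\<^esub> k) \<oplus>\<^bsub>A\<^esub> bar g \<otimes>\<^bsub>A\<^esub> fs (u @ v))"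
    by (simp add: IH bar_mult smult_mult_right M.smult_r_distr)
  also have "\<dots> = \<alpha> h k \<odot>\<^bsub>A\<^esub> (\<alpha> g (h \<otimes>\<^bsub>G\<^esub> k) \<odot>\<^bsub>A\<^esub> fs (x # u @ v))"
    using fs_Cons[of x "u @ v"] x u v by (simp add: g_def h_def k_def del: Un_iff)
  also have "\<dots> = \<alpha> g h \<odot>\<^bsub>A\<^esub> (\<alpha> (g \<otimes>\<^bsub>G\<^esub> h) k \<odot>\<^bsub>A\<^esub> fs (x # u @ v))"
    using alpha_cocycle[of g h k] by (simp add: M.smult_assoc1[symmetric])
  finally have "fs (x # u) \<otimes>\<^bsub>A\<^esub> bar k \<oplus>\<^bsub>A\<^esub> bar (g \<otimes>\<^bsub>G\<^esub> h) \<otimes>\<^bsub>A\<^esub> fs v = \<alpha> (g \<otimes>\<^bsub>G\<^esub> h) k \<odot>\<^bsub>A\<^esub> fs (x # u @ v)"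
    by (rule smult_cancel[rotated 3]) simp_all
  then show ?case by (simp add: g_def h_def k_def)
qed

lemma fs_singleton: "fs [x] = fl x"
  by (simp add: fstar_def Let_def)

section \<open>Invariance of the Fox derivative under the relations\<close>

text \<open>
  Up to the unit \<open>u\<close>, \<open>b\<close> is the inverse of \<open>bar g\<close>, on both sides with the same \<open>u\<close>
  because \<open>\<alpha> g (inv g) = \<alpha> (inv g) g\<close>.
\<close>

lemma bar_conj_cancel:
  assumes g [simp]: "g \<in> carrier G" and a [simp]: "a \<in> carrier A"
  defines "b \<equiv> bar (inv\<^bsub>G\<^esub> g)" and "u \<equiv> \<alpha> g (inv\<^bsub>G\<^esub> g)"
  shows "bar g \<otimes>\<^bsub>A\<^esub> (inv\<^bsub>R\<^esub> u \<odot>\<^bsub>A\<^esub> (b \<otimes>\<^bsub>A\<^esub> a \<otimes>\<^bsub>A\<^esub> b)) = a \<otimes>\<^bsub>A\<^esub> b"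
    and "(inv\<^bsub>R\<^esub> u \<odot>\<^bsub>A\<^esub> (b \<otimes>\<^bsub>A\<^esub> a \<otimes>\<^bsub>A\<^esub> b)) \<otimes>\<^bsub>A\<^esub> bar g = b \<otimes>\<^bsub>A\<^esub> a"
proof -
  have b [simp]: "b \<in> carrier A" and u [simp]: "u \<in> Units R" "u \<in> carrier R"
    by (simp_all add: b_def u_def)
  have gb: "bar g \<otimes>\<^bsub>A\<^esub> b = u \<odot>\<^bsub>A\<^esub> bar \<one>\<^bsub>G\<^esub>" and bg: "b \<otimes>\<^bsub>A\<^esub> bar g = u \<odot>\<^bsub>A\<^esub> bar \<one>\<^bsub>G\<^esub>"
    by (simp_all add: b_def u_def bar_mult alpha_inv_commute)
  have "bar g \<otimes>\<^bsub>A\<^esub> (inv\<^bsub>R\<^esub> u \<odot>\<^bsub>A\<^esub> (b \<otimes>\<^bsub>A\<^esub> a \<otimes>\<^bsub>A\<^esub> b)) = inv\<^bsub>R\<^esub> u \<odot>\<^bsub>A\<^esub> ((bar g \<otimes>\<^bsub>A\<^esub> b) \<otimes>\<^bsub>A\<^esub> (a \<otimes>\<^bsub>A\<^esub> b))"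
    by (simp add: smult_mult_right A.m_assoc)
  then show "bar g \<otimes>\<^bsub>A\<^esub> (inv\<^bsub>R\<^esub> u \<odot>\<^bsub>A\<^esub> (b \<otimes>\<^bsub>A\<^esub> a \<otimes>\<^bsub>A\<^esub> b)) = a \<otimes>\<^bsub>A\<^esub> b"
    by (simp add: gb smult_mult_left bar_one_mult M.smult_assoc1[symmetric])
  have "(inv\<^bsub>R\<^esub> u \<odot>\<^bsub>A\<^esub> (b \<otimes>\<^bsub>A\<^esub> a \<otimes>\<^bsub>A\<^esub> b)) \<otimes>\<^bsub>A\<^esub> bar g = inv\<^bsub>R\<^esub> u \<odot>\<^bsub>A\<^esub> ((b \<otimes>\<^bsub>A\<^esub> a) \<otimes>\<^bsub>A\<^esub> (b \<otimes>\<^bsub>A\<^esub> bar g))"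
    by (simp add: smult_mult_left A.m_assoc)
  then show "(inv\<^bsub>R\<^esub> u \<odot>\<^bsub>A\<^esub> (b \<otimes>\<^bsub>A\<^esub> a \<otimes>\<^bsub>A\<^esub> b)) \<otimes>\<^bsub>A\<^esub> bar g = b \<otimes>\<^bsub>A\<^esub> a"
    by (simp add: bg smult_mult_right bar_one_mult M.smult_assoc1[symmetric])
qed

lemma fl_Inv:
  assumes "s \<in> S"
  shows "fl (Inv s) = \<ominus>\<^bsub>A\<^esub> (inv\<^bsub>R\<^esub> \<alpha> (\<iota> s) (inv\<^bsub>G\<^esub> \<iota> s) \<odot>\<^bsub>A\<^esub>
    (bar (inv\<^bsub>G\<^esub> \<iota> s) \<otimes>\<^bsub>A\<^esub> f s \<otimes>\<^bsub>A\<^esub> bar (inv\<^bsub>G\<^esub> \<iota> s)))"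
  using assms generator_closed by (simp add: Let_def alpha_inv_commute)

text \<open>
  The value of \<open>f\<^sup>*\<close> on an inverse letter is chosen so that this holds: it is what the Leibniz rule
  prescribes.
\<close>

lemma fs_letter_inv:
  assumes x: "x \<in> letters S"
  shows "fs [x, letter_inv x] = \<zero>\<^bsub>A\<^esub>"
proof -
  obtain s where s: "s \<in> S" "x = Gen s \<or> x = Inv s"
    using x by auto
  then have g: "\<iota> s \<in> carrier G" and f: "f s \<in> carrier A"
    using generator_closed f_closed by simp_all
  have "fl x \<otimes>\<^bsub>A\<^esub> bar (lval (letter_inv x)) \<oplus>\<^bsub>A\<^esub> bar (lval x) \<otimes>\<^bsub>A\<^esub> fl (letter_inv x) = \<zero>\<^bsub>A\<^esub>"
    using s(2)
  proof
    assume "x = Gen s"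
    then show ?thesis
      using s(1) g f bar_conj_cancel(1)[OF g f]
      by (simp add: fl_Inv A.r_minus M.M.r_neg del: fstar_letter.simps(2))
  next
    assume "x = Inv s"
    then show ?thesis
      using s(1) g f bar_conj_cancel(2)[OF g f]
      by (simp add: fl_Inv A.l_minus M.M.l_neg del: fstar_letter.simps(2))
  qed
  moreover have w: "[x, letter_inv x] \<in> words S"
    using x letter_inv_letters[OF x] by simp
  ultimately have "\<alpha> (lval x) (lval (letter_inv x)) \<odot>\<^bsub>A\<^esub> fs [x, letter_inv x] = \<zero>\<^bsub>A\<^esub>"
    using fs_Cons[OF w] x by (simp add: fs_singleton del: Un_iff)
  also have "\<zero>\<^bsub>A\<^esub> = \<alpha> (lval x) (lval (letter_inv x)) \<odot>\<^bsub>A\<^esub> \<zero>\<^bsub>A\<^esub>"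
    using x by (simp del: Un_iff)
  finally show ?thesis
    by (rule smult_cancel[rotated 3]) (use x fs_closed[OF w] in \<open>simp_all del: Un_iff\<close>)
qed

lemma wval_letter_inv: "x \<in> letters S \<Longrightarrow> wval [x, letter_inv x] = \<one>\<^bsub>G\<^esub>"
  using lval_closed[of x] by (simp add: lval_letter_inv del: Un_iff lval_closed)

text \<open>
  For words with value \<open>1\<close> the Leibniz rule has no twisting factor, so a word with value \<open>1\<close> and
  \<open>f\<^sup>* = 0\<close> can be deleted from the front of any word.
\<close>

lemma fs_append_trivial:
  assumes "u \<in> words S" "v \<in> words S" "wval u = \<one>\<^bsub>G\<^esub>" "fs u = \<zero>\<^bsub>A\<^esub>"
  shows "fs (u @ v) = fs v"
  using fs_append[OF assms(1,2)] assms by (simp add: bar_one_mult)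

lemma fs_append_cong:
  assumes "u \<in> words S" "v \<in> words S" "v' \<in> words S" "wval v = wval v'" "fs v = fs v'"
  shows "fs (u @ v) = fs (u @ v')"
proof (rule smult_cancel)
  show "\<alpha> (wval u) (wval v) \<odot>\<^bsub>A\<^esub> fs (u @ v) = \<alpha> (wval u) (wval v) \<odot>\<^bsub>A\<^esub> fs (u @ v')"
    using fs_append[of u v] fs_append[of u v'] assms by simp
qed (use assms in simp_all)

text \<open>
  Free cancellation deletes a subword \<open>x x\<inverse>\<close>, which has value \<open>1\<close> and \<open>f\<^sup>* = 0\<close>.
\<close>

lemma free_rel_wval_fs:
  "(u, v) \<in> free_rel S \<Longrightarrow> wval u = wval v \<and> fs u = fs v"
proof (induction rule: free_rel.induct)
  case (cancel u x v)
  then have u: "u \<in> words S" and v: "v \<in> words S" and x: "x \<in> letters S"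
    and xx: "[x, letter_inv x] \<in> words S"
    by simp_all
  have val: "wval ([x, letter_inv x] @ v) = wval v"
    using wval_append[OF xx v] wval_letter_inv[OF x] v by simp
  have "fs ([x, letter_inv x] @ v) = fs v"
    using xx v wval_letter_inv[OF x] fs_letter_inv[OF x] by (rule fs_append_trivial)
  then have "fs (u @ [x, letter_inv x] @ v) = fs (u @ v)"
    using u v xx val by (intro fs_append_cong) (simp_all del: append.simps)
  moreover have "wval (u @ [x, letter_inv x] @ v) = wval (u @ v)"
    using u v xx val by (simp del: append.simps word_val_Cons)
  ultimately show ?case by blast
qed auto

text \<open>
  The Leibniz rule shows that the words with value \<open>1\<close> and \<open>f\<^sup>* = 0\<close> are closed under
  concatenation, inversion and conjugation; if they include the relators, they are all the words with
  value \<open>1\<close>.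
\<close>

lemma fs_kernel:
  assumes pres: "presentation G \<iota> S T" and T: "\<forall>t\<in>T. fs t = \<zero>\<^bsub>A\<^esub>"
    and w: "w \<in> words S" "wval w = \<one>\<^bsub>G\<^esub>"
  shows "fs w = \<zero>\<^bsub>A\<^esub>"
proof -
  have group: "group G" ..
  have "w \<in> words S \<and> wval w = \<one>\<^bsub>G\<^esub> \<and> fs w = \<zero>\<^bsub>A\<^esub>"
    using group pres w
  proof (induction rule: presentation_kernel_induct)
    case Nil
    show ?case by simp
  next
    case (relator t)
    then show ?case
      using T pres presentation_relator_val[OF group pres] by (auto simp: presentation_def)
  next
    case (free_rel u v)
    then show ?case using free_rel_words[of u v S] free_rel_wval_fs[of u v] by auto
  next
    case (append u v)
    then show ?case by (simp add: fs_append_trivial)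
  next
    case (inverse u)
    have "wval (u @ word_inv u) = \<one>\<^bsub>G\<^esub>" "fs (u @ word_inv u) = \<zero>\<^bsub>A\<^esub>"
      using free_rel_wval_fs[OF free_rel_word_inv[OF inverse(1)]] by simp_all
    then show ?case
      using inverse by (simp add: fs_append_trivial)
  next
    case (conj u v)
    have inv: "wval (v @ word_inv v) = \<one>\<^bsub>G\<^esub>" "fs (v @ word_inv v) = \<zero>\<^bsub>A\<^esub>"
      using free_rel_wval_fs[OF free_rel_word_inv[OF conj(2)]] by simp_all
    have "fs (v @ (u @ word_inv v)) = fs (v @ word_inv v)"
      using conj by (intro fs_append_cong) (simp_all add: fs_append_trivial)
    then show ?case using conj inv by simp
  qed
  then show ?thesis by blast
qed

text \<open>
  Inserting \<open>v\<inverse> v\<close> after \<open>u\<close> changes nothing by free invariance, and then the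
  front part \<open>u v\<inverse>\<close>, which is trivial in \<open>G\<close>, can be deleted.
\<close>

lemma fs_well_defined:
  assumes pres: "presentation G \<iota> S T" and T: "\<forall>t\<in>T. fs t = \<zero>\<^bsub>A\<^esub>"
    and u: "u \<in> words S" and v: "v \<in> words S" and uv: "wval u = wval v"
  shows "fs u = fs v"
proof -
  have inv: "(v @ word_inv v, []) \<in> free_rel S" "(word_inv v @ v, []) \<in> free_rel S"
    using free_rel_word_inv[of v S] free_rel_word_inv[of "word_inv v" S] v by simp_all
  have val: "wval (u @ word_inv v) = \<one>\<^bsub>G\<^esub>"
    using free_rel_wval_fs[OF inv(1)] u v uv by simp
  have "fs u = fs (u @ (word_inv v @ v))"
    using fs_append_cong[of u "[]" "word_inv v @ v"] free_rel_wval_fs[OF inv(2)] u v by simp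
  also have "\<dots> = fs ((u @ word_inv v) @ v)" by simp
  also have "\<dots> = fs v"
    using u v val fs_kernel[OF pres T _ val] by (intro fs_append_trivial) simp_all
  finally show ?thesis .
qed

section \<open>A derivation is determined on words\<close>

text \<open>
  For an inverse letter, apply \<open>d\<close> to \<open>b (bar g) = u \<odot> 1\<close>, where \<open>d\<close> vanishes on the right-hand
  side, and solve for \<open>d b\<close>.
\<close>

lemma derivation_letter:
  assumes d: "R_derivation R G \<alpha> d" and ext: "extends R G \<iota> S f d" and x: "x \<in> letters S"
  shows "d (bar (lval x)) = fl x"
proof -
  obtain s where s: "s \<in> S" "x = Gen s \<or> x = Inv s"
    using x by auto
  have gen: "d (bar (\<iota> s)) = f s"
    using ext s by (simp add: extends_def)
  from s(2) show ?thesis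
  proof
    assume "x = Gen s"
    then show ?thesis using gen by simp
  next
    assume x: "x = Inv s"
    define g b u where "g = \<iota> s" and "b = bar (inv\<^bsub>G\<^esub> g)" and "u = \<alpha> g (inv\<^bsub>G\<^esub> g)"
    have g [simp]: "g \<in> carrier G" and f [simp]: "f s \<in> carrier A"
      using s generator_closed f_closed by (simp_all add: g_def)
    have [simp]: "b \<in> carrier A" "u \<in> Units R" "u \<in> carrier R"
      by (simp_all add: b_def u_def)
    have [simp]: "d b \<in> carrier A"
      using d by (auto simp: R_derivation_iff)
    have bg: "b \<otimes>\<^bsub>A\<^esub> bar g = u \<odot>\<^bsub>A\<^esub> bar \<one>\<^bsub>G\<^esub>" and gb: "bar g \<otimes>\<^bsub>A\<^esub> b = u \<odot>\<^bsub>A\<^esub> bar \<one>\<^bsub>G\<^esub>"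
      by (simp_all add: b_def u_def bar_mult alpha_inv_commute)
    have "d b \<otimes>\<^bsub>A\<^esub> bar g \<oplus>\<^bsub>A\<^esub> b \<otimes>\<^bsub>A\<^esub> f s = d (b \<otimes>\<^bsub>A\<^esub> bar g)"
      using d gen by (simp add: R_derivation_iff g_def)
    also have "\<dots> = \<zero>\<^bsub>A\<^esub>"
      using d by (simp add: bg R_derivation_iff)
    finally have "d b \<otimes>\<^bsub>A\<^esub> bar g = \<ominus>\<^bsub>A\<^esub> (b \<otimes>\<^bsub>A\<^esub> f s)"
      by (simp add: M.M.minus_equality)
    then have "u \<odot>\<^bsub>A\<^esub> d b = \<ominus>\<^bsub>A\<^esub> (b \<otimes>\<^bsub>A\<^esub> f s) \<otimes>\<^bsub>A\<^esub> b"
      using gb A.m_assoc[of "d b" "bar g" b] by (simp add: smult_mult_right bar_one_mult)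
    also have "\<dots> = u \<odot>\<^bsub>A\<^esub> (\<ominus>\<^bsub>A\<^esub> (inv\<^bsub>R\<^esub> u \<odot>\<^bsub>A\<^esub> (b \<otimes>\<^bsub>A\<^esub> f s \<otimes>\<^bsub>A\<^esub> b)))"
      by (simp add: A.l_minus M.smult_r_minus M.smult_assoc1[symmetric])
    finally have "d b = \<ominus>\<^bsub>A\<^esub> (inv\<^bsub>R\<^esub> u \<odot>\<^bsub>A\<^esub> (b \<otimes>\<^bsub>A\<^esub> f s \<otimes>\<^bsub>A\<^esub> b))"
      by (rule smult_cancel[rotated 3]) simp_all
    then show ?thesis
      using s x by (simp add: fl_Inv b_def u_def g_def del: fstar_letter.simps(2))
  qed
qed

text \<open>
  A derivation satisfies the same recursion along words as \<open>f\<^sup>*\<close>.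
\<close>

lemma derivation_word:
  assumes d: "R_derivation R G \<alpha> d" and ext: "extends R G \<iota> S f d" and w: "w \<in> words S"
  shows "d (bar (wval w)) = fs w"
  using w
proof (induction w)
  case Nil
  have "d (\<one>\<^bsub>R\<^esub> \<odot>\<^bsub>A\<^esub> bar \<one>\<^bsub>G\<^esub>) = \<zero>\<^bsub>A\<^esub>"
    using d by (simp add: R_derivation_iff del: M.smult_one)
  then show ?case by simp
next
  case (Cons x w)
  then have x: "x \<in> letters S" and w: "w \<in> words S" by simp_all
  have d_closed [simp]: "d (bar g) \<in> carrier A" for g
    using d by (auto simp: R_derivation_iff)
  have "\<alpha> (lval x) (wval w) \<odot>\<^bsub>A\<^esub> d (bar (wval (x # w))) = d (bar (lval x) \<otimes>\<^bsub>A\<^esub> bar (wval w))"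
    using x w d by (simp add: bar_mult R_derivation_smult del: Un_iff)
  also have "\<dots> = fl x \<otimes>\<^bsub>A\<^esub> bar (wval w) \<oplus>\<^bsub>A\<^esub> bar (lval x) \<otimes>\<^bsub>A\<^esub> fs w"
    using d Cons.IH[OF w] derivation_letter[OF d ext x] by (simp add: R_derivation_iff)
  also have "\<dots> = \<alpha> (lval x) (wval w) \<odot>\<^bsub>A\<^esub> fs (x # w)"
    using fs_Cons[OF Cons.prems] by simp
  finally show ?case
    by (rule smult_cancel[rotated 3])
      (use x w fs_closed[OF Cons.prems] in \<open>simp_all del: Un_iff\<close>)
qed

end

section \<open>Existence and uniqueness of the extension\<close>

theorem mainTheorem4:
  fixes R :: "('r, 'n) ring_scheme" and G :: "('g, 'm) monoid_scheme"
    and \<alpha> :: "'g \<Rightarrow> 'g \<Rightarrow> 'r" and \<iota> :: "'s \<Rightarrow> 'g" and S :: "'s set"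
    and T :: "'s letter list set" and f :: "'s \<Rightarrow> 'g \<Rightarrow> 'r"
  assumes "cring R" and "group G"
    and "presentation G \<iota> S T"
    and "normalized_cocycle R G \<alpha>"
    and "f \<in> S \<rightarrow> carrier (twisted_group_ring R G \<alpha>)"
  shows "(\<forall>d. R_derivation R G \<alpha> d \<and> extends R G \<iota> S f d \<longrightarrow>
      (\<forall>d'. R_derivation R G \<alpha> d' \<and> extends R G \<iota> S f d' \<longrightarrow>
        (\<forall>a\<in>carrier (twisted_group_ring R G \<alpha>). d' a = d a)) \<and>
      (\<forall>g\<in>carrier G. \<forall>w\<in>words S. word_val G \<iota> w = g \<longrightarrow>
        d (basis_elt R G g) = fstar R G \<alpha> \<iota> f w) \<and>
      (\<forall>\<omega>. (\<forall>g\<in>carrier G. \<omega> g \<in> words S \<and> word_val G \<iota> (\<omega> g) = g) \<longrightarrow>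
        (\<forall>a\<in>carrier (twisted_group_ring R G \<alpha>).
          d a = (\<Oplus>\<^bsub>twisted_group_ring R G \<alpha>\<^esub>g\<in>supp R G a.
            a g \<odot>\<^bsub>twisted_group_ring R G \<alpha>\<^esub> fstar R G \<alpha> \<iota> f (\<omega> g)))))
    \<and> ((\<exists>d. R_derivation R G \<alpha> d \<and> extends R G \<iota> S f d)
        \<longleftrightarrow> (\<forall>t\<in>T. fstar R G \<alpha> \<iota> f t = \<zero>\<^bsub>twisted_group_ring R G \<alpha>\<^esub>))"
proof -
  interpret G: group G by (rule assms(2))
  interpret twisted R G \<alpha>
    by (intro twisted.intro twisted_axioms.intro assms)
  interpret twisted_words R G \<alpha> \<iota> S f
    by unfold_locales (use assms(5) presentation_generator_closed[OF assms(2,3)] in auto)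
  have words_exist: "\<exists>w\<in>words S. wval w = g" if "g \<in> carrier G" for g
    using presentation_word_exists[OF assms(2,3) that] .
  have formula: "d a = (\<Oplus>\<^bsub>A\<^esub>g\<in>supp R G a. a g \<odot>\<^bsub>A\<^esub> fs (\<omega> g))"
    if d: "R_derivation R G \<alpha> d" "extends R G \<iota> S f d"
      and \<omega>: "\<forall>g\<in>carrier G. \<omega> g \<in> words S \<and> wval (\<omega> g) = g" and a: "a \<in> carrier A" for d \<omega> a
  proof -
    have eq: "d (bar g) = fs (\<omega> g)" if "g \<in> carrier G" for g
      using derivation_word[OF d, of "\<omega> g"] \<omega> that by simp
    have "d a = (\<Oplus>\<^bsub>A\<^esub>g\<in>supp R G a. a g \<odot>\<^bsub>A\<^esub> d (bar g))"
      using R_derivation_eq_lin_ext[OF d(1) a] by (simp add: lin_ext_def)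
    also have "\<dots> = (\<Oplus>\<^bsub>A\<^esub>g\<in>supp R G a. a g \<odot>\<^bsub>A\<^esub> fs (\<omega> g))"
      using a \<omega> by (intro M.M.finsum_cong') (auto simp: in_supp_iff eq)
    finally show ?thesis .
  qed
  \<comment> \<open>A choice of a representing word for every group element; some such choice exists because the generators generate \<open>G\<close>.\<close>
  define \<omega> where "\<omega> g = (SOME w. w \<in> words S \<and> wval w = g)" for g
  have \<omega>: "\<omega> g \<in> words S" "wval (\<omega> g) = g" if "g \<in> carrier G" for g
  proof -
    have "\<exists>w. w \<in> words S \<and> wval w = g" using words_exist[OF that] by blast
    from someI_ex[OF this] show "\<omega> g \<in> words S" "wval (\<omega> g) = g" by (simp_all add: \<omega>_def)
  qed
  have unique: "d' a = d a"
    if "R_derivation R G \<alpha> d" "extends R G \<iota> S f d"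
      "R_derivation R G \<alpha> d'" "extends R G \<iota> S f d'" "a \<in> carrier A" for d d' a
    using formula[of d \<omega> a] formula[of d' \<omega> a] that \<omega> by simp
  have necessary: "fs t = \<zero>\<^bsub>A\<^esub>"
    if d: "R_derivation R G \<alpha> d" "extends R G \<iota> S f d" and t: "t \<in> T" for d t
  proof -
    have t_words: "t \<in> words S"
      using t assms(3) by (auto simp: presentation_def)
    have "fs t = d (bar \<one>\<^bsub>G\<^esub>)"
      using derivation_word[OF d t_words] presentation_relator_val[OF assms(2,3) t] by simp
    also have "\<dots> = fs []"
      using derivation_word[OF d, of "[]"] by simp
    finally show ?thesis by simp
  qed
  have sufficient: "\<exists>d. R_derivation R G \<alpha> d \<and> extends R G \<iota> S f d"
    if T: "\<forall>t\<in>T. fs t = \<zero>\<^bsub>A\<^esub>"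
  proof -
    note well_defined = fs_well_defined[OF assms(3) T]
    \<comment> \<open>By well-definedness this does not depend on \<open>\<omega>\<close>, so \<open>\<omega> g @ \<omega> h\<close> may be used as the word for \<open>g h\<close>.\<close>
    define D where "D g = fs (\<omega> g)" for g
    have D: "D \<in> carrier G \<rightarrow> carrier A"
      using \<omega> by (auto simp: D_def)
    have D_val: "D (wval w) = fs w" if "w \<in> words S" for w
      using well_defined[of "\<omega> (wval w)" w] that \<omega>[of "wval w"] by (simp add: D_def)
    have Leibniz: "\<alpha> g h \<odot>\<^bsub>A\<^esub> D (g \<otimes>\<^bsub>G\<^esub> h) = D g \<otimes>\<^bsub>A\<^esub> bar h \<oplus>\<^bsub>A\<^esub> bar g \<otimes>\<^bsub>A\<^esub> D h"
      if "g \<in> carrier G" "h \<in> carrier G" for g h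
      using fs_append[of "\<omega> g" "\<omega> h"] D_val[of "\<omega> g @ \<omega> h"] \<omega>[OF that(1)] \<omega>[OF that(2)]
      by (simp add: D_def)
    have "lin_ext D (bar (\<iota> s)) = f s" if s: "s \<in> S" for s
    proof -
      have g: "\<iota> s \<in> carrier G" using generator_closed[OF s] .
      have "lin_ext D (bar (\<iota> s)) = D (\<iota> s)"
        using lin_ext_monomial[OF D R.one_closed g] D g by (simp add: Pi_iff)
      then show ?thesis
        using D_val[of "[Gen s]"] s g by (simp add: fs_singleton)
    qed
    then show ?thesis
      using lin_ext_R_derivation[OF D Leibniz] by (auto simp: extends_def)
  qed
  show ?thesis
    using unique formula derivation_word necessary sufficient
    by (intro conjI allI impI ballI iffI) (blast | metis)+
qed

end
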